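(* Let $U\subseteq\mathbb{R}^N$ be open and let $F:U\to\mathbb{R}^M$ be a $C^\infty$ function. Suppose that $F$ has almost constant rank (ACR). Then $F$ is $d$-flat with $d=N-\operatorname{maxrank}(F)$; that is, for Lebesgue almost every $p\in U$, the set $\operatorname{SolSet}(p)=\{x\in U: F(x)=F(p)\}$ is a manifold of dimension $d=N-\operatorname{maxrank}(F)$.
   Context: $DF(x)$ is the $M\times N$ Jacobian matrix of $F$ at $x$. $F$ has almost constant rank (is ACR) if there is an integer $\rho\ge 0$ such that $\operatorname{rank}(DF(x))=\rho$ for Lebesgue almost every $x\in U$. $\operatorname{maxrank}(F)=\max_{x\in U}\operatorname{rank}(DF(x))$. $F$ is called $d$-flat if $\operatorname{SolSet}(p)$ is a $d$-dimensional manifold for Lebesgue almost every $p\in U$. "Manifold" means $C^\infty$ manifold without boundary (not necessarily compact or connected); for a subset of $U$ this means an embedded (regular) $C^\infty$ submanifold of $U$. *)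

theory Defs
  imports "HOL-Analysis.Analysis"
begin

(* All notions below are meant for functions on an open set S (or U): the derivative "at x" then
   depends only on the restriction of f to that set, so values outside it are irrelevant. *)

primrec Ck_on :: "nat \<Rightarrow> ('a::real_normed_vector \<Rightarrow> 'b::real_normed_vector) \<Rightarrow> 'a set \<Rightarrow> bool" where
  "Ck_on 0 f S \<longleftrightarrow> continuous_on S f"
| "Ck_on (Suc k) f S \<longleftrightarrow>
     (\<forall>x\<in>S. f differentiable (at x)) \<and> (\<forall>v. Ck_on k (\<lambda>x. frechet_derivative f (at x) v) S)"

definition smooth_on :: "('a::real_normed_vector \<Rightarrow> 'b::real_normed_vector) \<Rightarrow> 'a set \<Rightarrow> bool" where
  "smooth_on f S \<longleftrightarrow> (\<forall>k. Ck_on k f S)"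

definition diffeomorphism ::
  "'a::real_normed_vector set \<Rightarrow> 'b::real_normed_vector set \<Rightarrow> ('a \<Rightarrow> 'b) \<Rightarrow> ('b \<Rightarrow> 'a) \<Rightarrow> bool" where
  "diffeomorphism V W \<phi> \<psi> \<longleftrightarrow>
     open V \<and> open W \<and> homeomorphism V W \<phi> \<psi> \<and> smooth_on \<phi> V \<and> smooth_on \<psi> W"

(* Slice charts: the index type has no canonical order, so the coordinate subspace R^d x {0} is
   given by an arbitrary set I of d coordinates that remain free. *)
definition embedded_submanifold :: "(real^'n::finite) set \<Rightarrow> nat \<Rightarrow> (real^'n) set \<Rightarrow> bool" where
  "embedded_submanifold U d S \<longleftrightarrow>
     S \<subseteq> U \<and>
     (\<forall>p\<in>S. \<exists>V W \<phi> \<psi> I.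
        p \<in> V \<and> V \<subseteq> U \<and> diffeomorphism V W \<phi> \<psi> \<and> card I = d \<and>
        \<phi> ` (S \<inter> V) = W \<inter> {y :: real^'n. \<forall>i. i \<notin> I \<longrightarrow> y $ i = 0})"

definition ACR :: "(real^'n::finite) set \<Rightarrow> (real^'n \<Rightarrow> real^'m::finite) \<Rightarrow> bool" where
  "ACR U F \<longleftrightarrow> (\<exists>\<rho>. AE x in lebesgue_on U. rank (jacobian F (at x)) = \<rho>)"

(* Max ranges over a finite set of ranks; its value is unspecified for empty U only. *)
definition maxrank :: "(real^'n::finite) set \<Rightarrow> (real^'n \<Rightarrow> real^'m::finite) \<Rightarrow> nat" where
  "maxrank U F = Max ((\<lambda>x. rank (jacobian F (at x))) ` U)"

definition SolSet :: "'a set \<Rightarrow> ('a \<Rightarrow> 'b) \<Rightarrow> 'a \<Rightarrow> 'a set" where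
  "SolSet U F p = {x \<in> U. F x = F p}"

definition d_flat :: "nat \<Rightarrow> (real^'n::finite) set \<Rightarrow> (real^'n \<Rightarrow> real^'m::finite) \<Rightarrow> bool" where
  "d_flat d U F \<longleftrightarrow> (AE p in lebesgue_on U. embedded_submanifold U d (SolSet U F p))"

end

theory Submission
  imports Defs
begin

text \<open>
  Almost constant rank forces the rank of \<open>DF\<close> to equal its maximum \<open>r\<close> almost everywhere. Where the
  rank is \<open>r\<close> it is locally constant, so \<open>F\<close> is locally a function of \<open>r\<close> of its own components, which
  can be completed to a chart; a fibre that avoids the set \<open>Z\<close> of points of smaller rank is therefore
  a submanifold of codimension \<open>r\<close>. That almost every fibre avoids \<open>Z\<close> does not follow from \<open>Z\<close> being
  null, but from the Morse--Sard theorem: if \<open>G\<close> consists of the \<open>r\<close> components chosen near a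
  point of rank \<open>r\<close>, then every point of \<open>Z\<close> is critical for \<open>G\<close>, so \<open>G(Z)\<close> is null, and so is its preimage
  under the local submersion \<open>G\<close>.

  Sard's theorem is proved in Milnor's way. Points where some partial derivative of \<open>G\<close> is nonzero
  are handled by making a component of \<open>G\<close> a coordinate and slicing (Fubini); points where \<open>DG = 0\<close>
  only require the scalar case, in which one takes a vanishing iterated partial derivative with nonzero
  differential as a coordinate, or else uses that flat points have a null image. Since dimensions are types, the
  inductions run over subsets of the coordinates of one fixed space.
\<close>

subsection \<open>Calculus of $C^k$ maps\<close>

text \<open>Derivatives at a point depend only on nearby values, and \<open>S\<close> is open, so
  agreement on \<open>S\<close> passes to all derivatives. Its use is to replace a derivative by an
  explicit formula valid on \<open>S\<close>.\<close>

lemma Ck_on_cong: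
  assumes "open S" "\<And>x. x \<in> S \<Longrightarrow> f x = g x" "Ck_on k f S"
  shows "Ck_on k g S"
  using assms(2,3)
proof (induction k arbitrary: f g)
  case 0
  then show ?case by (simp cong: continuous_on_cong)
next
  case (Suc k)
  have *: "frechet_derivative f (at x) = frechet_derivative g (at x)" if "x \<in> S" for x
    using frechet_derivative_transform_within_open[of f x S g] Suc.prems that \<open>open S\<close> by simp
  have "g differentiable (at x)" if "x \<in> S" for x
    using Suc.prems that \<open>open S\<close>
    by (metis Ck_on.simps(2) differentiable_def has_derivative_transform_within_open)
  moreover have "Ck_on k (\<lambda>x. frechet_derivative g (at x) v) S" for v
    using Suc.IH[of "\<lambda>x. frechet_derivative f (at x) v" "\<lambda>x. frechet_derivative g (at x) v"] *
      Suc.prems(2) by simp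
  ultimately show ?case by simp
qed

text \<open>By uniqueness of derivatives, any formula \<open>D\<close> valid on \<open>S\<close> may
  replace \<open>frechet_derivative\<close>. Through this rule the sum, product, inverse and chain
  rules enter the inductions on \<open>k\<close>.\<close>

lemma Ck_on_SucI:
  assumes "open S" "\<And>x. x \<in> S \<Longrightarrow> (f has_derivative D x) (at x)"
    "\<And>v. Ck_on k (\<lambda>x. D x v) S"
  shows "Ck_on (Suc k) f S"
proof -
  have "D x = frechet_derivative f (at x)" if "x \<in> S" for x
    using assms(2)[OF that] frechet_derivative_at by blast
  then show ?thesis
    using assms Ck_on_cong[OF \<open>open S\<close>, of "\<lambda>x. D x _" "\<lambda>x. frechet_derivative f (at x) _"]
    by (auto simp: differentiable_def)
qed

lemma Ck_on_SucD:
  assumes "Ck_on (Suc k) f S"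
  shows "\<And>x. x \<in> S \<Longrightarrow> (f has_derivative frechet_derivative f (at x)) (at x)"
    and "\<And>v. Ck_on k (\<lambda>x. frechet_derivative f (at x) v) S"
  using assms frechet_derivative_works by auto

lemma Ck_on_Suc_imp: "Ck_on (Suc k) f S \<Longrightarrow> Ck_on k f S"
proof (induction k arbitrary: f)
  case 0
  then show ?case
    by (auto intro!: continuous_at_imp_continuous_on differentiable_imp_continuous_within)
qed auto

lemma Ck_on_subset: "Ck_on k f S \<Longrightarrow> T \<subseteq> S \<Longrightarrow> Ck_on k f T"
  by (induction k arbitrary: f) (auto intro: continuous_on_subset)

lemma Ck_on_const: "Ck_on k (\<lambda>x. c) S"
  by (induction k arbitrary: c) (auto simp: continuous_on_const)

lemma Ck_on_bounded_linear:
  assumes "open S" "bounded_linear L"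
  shows "Ck_on k L S"
proof (cases k)
  case 0
  then show ?thesis using assms by (simp add: linear_continuous_on)
next
  case (Suc m)
  show ?thesis unfolding Suc
    by (rule Ck_on_SucI[OF \<open>open S\<close>])
      (use assms in \<open>auto intro: bounded_linear_imp_has_derivative Ck_on_const\<close>)
qed

lemma Ck_on_linear_comp:
  assumes "open S" "bounded_linear L" "Ck_on k f S"
  shows "Ck_on k (\<lambda>x. L (f x)) S"
  using assms(3)
proof (induction k arbitrary: f)
  case 0
  then show ?case using assms(2) by (simp add: bounded_linear.continuous_on)
next
  case (Suc k)
  show ?case
  proof (rule Ck_on_SucI[OF \<open>open S\<close>])
    show "((\<lambda>x. L (f x)) has_derivative (\<lambda>v. L (frechet_derivative f (at x) v))) (at x)" if "x \<in> S" for x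
      using bounded_linear.has_derivative[OF assms(2) Ck_on_SucD(1)[OF Suc.prems that]] .
  qed (use Suc in auto)
qed

lemma Ck_on_add:
  assumes "open S" "Ck_on k f S" "Ck_on k g S"
  shows "Ck_on k (\<lambda>x. f x + g x) S"
  using assms(2,3)
proof (induction k arbitrary: f g)
  case 0
  then show ?case by (simp add: continuous_on_add)
next
  case (Suc k)
  show ?case
    by (rule Ck_on_SucI[OF \<open>open S\<close> has_derivative_add[OF Ck_on_SucD(1) Ck_on_SucD(1)]])
      (use Suc in auto)
qed

lemma Ck_on_sum:
  assumes "open S" "\<And>i. i \<in> A \<Longrightarrow> Ck_on k (f i) S"
  shows "Ck_on k (\<lambda>x. \<Sum>i\<in>A. f i x) S"
  using assms(2)
  by (induction A rule: infinite_finite_induct) (auto intro: Ck_on_const Ck_on_add[OF \<open>open S\<close>])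

lemma Ck_on_scaleR:
  fixes f :: "'a::real_normed_vector \<Rightarrow> real"
  assumes "open S" "Ck_on k f S" "Ck_on k g S"
  shows "Ck_on k (\<lambda>x. f x *\<^sub>R g x) S"
  using assms(2,3)
proof (induction k arbitrary: f g)
  case 0
  then show ?case by (simp add: continuous_on_scaleR)
next
  case (Suc k)
  show ?case
  proof (rule Ck_on_SucI[OF \<open>open S\<close> has_derivative_scaleR[OF Ck_on_SucD(1) Ck_on_SucD(1)]])
    show "Ck_on k (\<lambda>x. f x *\<^sub>R frechet_derivative g (at x) v + frechet_derivative f (at x) v *\<^sub>R g x) S"
      for v
      by (intro Ck_on_add[OF \<open>open S\<close>] Suc.IH Ck_on_Suc_imp[OF Suc.prems(1)] Ck_on_Suc_imp[OF Suc.prems(2)]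
        Ck_on_SucD(2)[OF Suc.prems(1)] Ck_on_SucD(2)[OF Suc.prems(2)])
  qed (use Suc in auto)
qed

lemma Ck_on_mult:
  fixes f g :: "'a::real_normed_vector \<Rightarrow> real"
  assumes "open S" "Ck_on k f S" "Ck_on k g S"
  shows "Ck_on k (\<lambda>x. f x * g x) S"
  using Ck_on_scaleR[OF assms] by simp

lemma Ck_on_prod:
  fixes f :: "'i \<Rightarrow> 'a::real_normed_vector \<Rightarrow> real"
  assumes "open S" "\<And>i. i \<in> A \<Longrightarrow> Ck_on k (f i) S"
  shows "Ck_on k (\<lambda>x. \<Prod>i\<in>A. f i x) S"
  using assms(2)
  by (induction A rule: infinite_finite_induct) (auto intro: Ck_on_const Ck_on_mult[OF \<open>open S\<close>])

lemma Ck_on_inverse: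
  fixes f :: "'a::real_normed_vector \<Rightarrow> real"
  assumes "open S" "Ck_on k f S" "\<And>x. x \<in> S \<Longrightarrow> f x \<noteq> 0"
  shows "Ck_on k (\<lambda>x. inverse (f x)) S"
  using assms(2)
proof (induction k)
  case 0
  then show ?case using assms(3) by (auto intro!: continuous_on_inverse)
next
  case (Suc k)
  show ?case
  proof (rule Ck_on_SucI[OF \<open>open S\<close>])
    show "((\<lambda>x. inverse (f x)) has_derivative
        (\<lambda>v. - (inverse (f x) * frechet_derivative f (at x) v * inverse (f x)))) (at x)"
      if "x \<in> S" for x
      using assms(3)[OF that] Ck_on_SucD(1)[OF Suc.prems that] by (rule Deriv.has_derivative_inverse)
    show "Ck_on k (\<lambda>x. - (inverse (f x) * frechet_derivative f (at x) v * inverse (f x))) S" for v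
      by (intro Ck_on_linear_comp[OF \<open>open S\<close>, of uminus] Ck_on_mult[OF \<open>open S\<close>] Suc.IH
        Ck_on_Suc_imp[OF Suc.prems] Ck_on_SucD(2)[OF Suc.prems] bounded_linear_minus bounded_linear_ident)
  qed
qed

lemma Ck_on_divide:
  fixes f g :: "'a::real_normed_vector \<Rightarrow> real"
  assumes "open S" "Ck_on k f S" "Ck_on k g S" "\<And>x. x \<in> S \<Longrightarrow> g x \<noteq> 0"
  shows "Ck_on k (\<lambda>x. f x / g x) S"
  unfolding divide_inverse
  by (intro Ck_on_mult Ck_on_inverse assms)

lemma Ck_on_vec_nth:
  fixes f :: "'a::real_normed_vector \<Rightarrow> real^'n::finite"
  assumes "open S" "Ck_on k f S"
  shows "Ck_on k (\<lambda>x. f x $ i) S"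
  by (rule Ck_on_linear_comp[OF assms(1) bounded_linear_vec_nth assms(2)])

lemma Ck_on_vec:
  fixes f :: "'a::real_normed_vector \<Rightarrow> real^'n::finite"
  assumes "open S"
  shows "Ck_on k f S \<longleftrightarrow> (\<forall>i. Ck_on k (\<lambda>x. f x $ i) S)"
proof
  assume "Ck_on k f S"
  then show "\<forall>i. Ck_on k (\<lambda>x. f x $ i) S"
    using Ck_on_vec_nth[OF assms] by blast
next
  assume *: "\<forall>i. Ck_on k (\<lambda>x. f x $ i) S"
  have "Ck_on k (\<lambda>x. \<Sum>i\<in>UNIV. f x $ i *\<^sub>R axis i (1::real)) S"
    using * by (intro Ck_on_sum Ck_on_scaleR Ck_on_const assms) auto
  moreover have "f x = (\<Sum>i\<in>UNIV. f x $ i *\<^sub>R axis i (1::real))" for x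
    using basis_expansion[of "f x"] by (simp add: scalar_mult_eq_scaleR)
  ultimately show "Ck_on k f S" by simp
qed

lemma linear_vec_expand:
  fixes L :: "real^'n::finite \<Rightarrow> 'b::real_vector"
  assumes "linear L"
  shows "L u = (\<Sum>i\<in>UNIV. u $ i *\<^sub>R L (axis i 1))"
proof -
  have "L u = L (\<Sum>i\<in>UNIV. u $ i *\<^sub>R axis i (1::real))"
    using basis_expansion[of u] by (simp add: scalar_mult_eq_scaleR)
  also have "\<dots> = (\<Sum>i\<in>UNIV. u $ i *\<^sub>R L (axis i 1))"
    using assms by (simp add: linear_sum linear_scale)
  finally show ?thesis .
qed

text \<open>In the chain rule the outer derivative is taken in a direction that moves with
  \<open>x\<close>, whereas \<open>Ck_on\<close> controls fixed directions only. Expanding that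
  direction in the standard basis gives a sum of scalars times partial derivatives of
  \<open>g\<close> along \<open>f\<close>, to which the induction hypothesis, general in
  \<open>g\<close>, applies.\<close>

lemma Ck_on_compose:
  fixes f :: "'a::real_normed_vector \<Rightarrow> real^'n::finite"
  assumes "open S" "open T" "f ` S \<subseteq> T" "Ck_on k f S" "Ck_on k g T"
  shows "Ck_on k (\<lambda>x. g (f x)) S"
  using assms(4,5)
proof (induction k arbitrary: g)
  case 0
  then show ?case using assms(3) by (auto intro: continuous_on_compose2)
next
  case (Suc k)
  show ?case
  proof (rule Ck_on_SucI[OF \<open>open S\<close>])
    fix x assume "x \<in> S"
    then have "f x \<in> T" using assms(3) by auto
    have "((\<lambda>x. g (f x)) has_derivative
        (\<lambda>v. frechet_derivative g (at (f x)) (frechet_derivative f (at x) v))) (at x)"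
      by (rule has_derivative_compose[OF Ck_on_SucD(1)[OF Suc.prems(1) \<open>x \<in> S\<close>]
            Ck_on_SucD(1)[OF Suc.prems(2) \<open>f x \<in> T\<close>]])
    moreover have "linear (frechet_derivative g (at (f x)))"
      using Suc.prems(2) \<open>f x \<in> T\<close> by (auto intro: linear_frechet_derivative)
    then have "frechet_derivative g (at (f x)) (frechet_derivative f (at x) v) =
        (\<Sum>i\<in>UNIV. frechet_derivative f (at x) v $ i *\<^sub>R
              frechet_derivative g (at (f x)) (axis i 1))" for v
      by (rule linear_vec_expand)
    ultimately show "((\<lambda>x. g (f x)) has_derivative
        (\<lambda>v. \<Sum>i\<in>UNIV. frechet_derivative f (at x) v $ i *\<^sub>R
              frechet_derivative g (at (f x)) (axis i 1))) (at x)"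
      by simp
  next
    fix v
    have "Ck_on k (\<lambda>x. frechet_derivative f (at x) v) S"
      using Suc.prems by auto
    then have "Ck_on k (\<lambda>x. frechet_derivative f (at x) v $ i) S" for i
      by (rule Ck_on_vec_nth[OF \<open>open S\<close>])
    then show "Ck_on k (\<lambda>x. \<Sum>i\<in>UNIV. frechet_derivative f (at x) v $ i *\<^sub>R
              frechet_derivative g (at (f x)) (axis i 1)) S"
      by (intro Ck_on_sum[OF \<open>open S\<close>] Ck_on_scaleR[OF \<open>open S\<close>] Suc.IH
          Ck_on_Suc_imp[OF Suc.prems(1)] Ck_on_SucD(2)[OF Suc.prems(2)])
  qed
qed

lemma Ck_on_det:
  fixes A :: "'a::real_normed_vector \<Rightarrow> real^'n::finite^'n"
  assumes "open S" "\<And>i j. Ck_on k (\<lambda>x. A x $ i $ j) S"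
  shows "Ck_on k (\<lambda>x. det (A x)) S"
  unfolding det_def
  by (intro Ck_on_sum Ck_on_mult Ck_on_prod Ck_on_const assms)

section \<open>Smooth maps and their derivatives\<close>

lemma smooth_onD: "smooth_on f S \<Longrightarrow> Ck_on k f S"
  by (auto simp: smooth_on_def)

lemma smooth_on_has_derivative:
  "smooth_on f S \<Longrightarrow> x \<in> S \<Longrightarrow> (f has_derivative frechet_derivative f (at x)) (at x)"
  using Ck_on_SucD(1) smooth_onD by blast

lemma smooth_on_linear_frechet_derivative:
  "smooth_on f S \<Longrightarrow> x \<in> S \<Longrightarrow> linear (frechet_derivative f (at x))"
  using has_derivative_linear smooth_on_has_derivative by blast

lemma smooth_on_frechet_derivative:
  "smooth_on f S \<Longrightarrow> smooth_on (\<lambda>x. frechet_derivative f (at x) v) S"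
  using Ck_on_SucD(2) unfolding smooth_on_def by blast

lemma smooth_on_imp_continuous_on: "smooth_on f S \<Longrightarrow> continuous_on S f"
  using smooth_onD[of f S 0] by simp

lemma smooth_on_subset: "smooth_on f S \<Longrightarrow> T \<subseteq> S \<Longrightarrow> smooth_on f T"
  unfolding smooth_on_def using Ck_on_subset by blast

lemma smooth_on_compose:
  fixes f :: "'a::real_normed_vector \<Rightarrow> real^'n::finite"
  assumes "open S" "open T" "f ` S \<subseteq> T" "smooth_on f S" "smooth_on g T"
  shows "smooth_on (\<lambda>x. g (f x)) S"
  using assms unfolding smooth_on_def by (blast intro: Ck_on_compose)

lemma smooth_on_vec:
  fixes f :: "'a::real_normed_vector \<Rightarrow> real^'n::finite"
  shows "open S \<Longrightarrow> smooth_on f S \<longleftrightarrow> (\<forall>i. smooth_on (\<lambda>x. f x $ i) S)"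
  unfolding smooth_on_def using Ck_on_vec by blast

lemma smooth_on_vec_nth:
  assumes "open S"
  shows "smooth_on (\<lambda>x::real^'n::finite. x $ i) S"
  using Ck_on_bounded_linear[OF assms bounded_linear_vec_nth] by (simp add: smooth_on_def)

lemma frechet_derivative_vec_nth:
  assumes "smooth_on f S" "x \<in> S"
  shows "frechet_derivative (\<lambda>x. f x $ i) (at x) v = frechet_derivative f (at x) v $ i"
proof -
  have "((\<lambda>x. f x $ i) has_derivative (\<lambda>v. frechet_derivative f (at x) v $ i)) (at x)"
    using bounded_linear.has_derivative[OF bounded_linear_vec_nth smooth_on_has_derivative[OF assms]] .
  from frechet_derivative_at[OF this] show ?thesis by metis
qed

lemma frechet_derivative_comp:
  assumes "smooth_on f S" "smooth_on g T" "x \<in> S" "f x \<in> T"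
  shows "frechet_derivative (\<lambda>x. g (f x)) (at x) v
    = frechet_derivative g (at (f x)) (frechet_derivative f (at x) v)"
proof -
  have "((\<lambda>x. g (f x)) has_derivative
      (\<lambda>v. frechet_derivative g (at (f x)) (frechet_derivative f (at x) v))) (at x)"
    by (rule has_derivative_compose[OF smooth_on_has_derivative smooth_on_has_derivative])
      (use assms in auto)
  from frechet_derivative_at[OF this] show ?thesis by metis
qed

subsection \<open>Smooth inverse function theorem\<close>

text \<open>The inverse function theorem yields a differentiable local inverse \<open>g\<close>; its
  smoothness is bootstrapped. If \<open>g\<close> is of class \<open>k\<close>, so are the entries
  of the derivative of \<open>f\<close> along \<open>g\<close>, hence also those of the inverse
  matrix, so \<open>g\<close> is of class \<open>Suc k\<close>.\<close>

lemma smooth_local_diffeomorphism: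
  fixes f :: "real^'n::finite \<Rightarrow> real^'n"
  assumes "open U" "smooth_on f U" "p \<in> U" "inj (frechet_derivative f (at p))"
  obtains V W g where "p \<in> V" "V \<subseteq> U" "diffeomorphism V W f g"
proof -
  define f' where "f' x = Blinfun (frechet_derivative f (at x))" for x
  have bl: "bounded_linear (frechet_derivative f (at x))" if "x \<in> U" for x
    using smooth_on_has_derivative[OF assms(2) that] by (rule has_derivative_bounded_linear)
  have f': "blinfun_apply (f' x) = frechet_derivative f (at x)" if "x \<in> U" for x
    unfolding f'_def using bl[OF that] by (rule bounded_linear_Blinfun_apply)
  have cont: "continuous_on U f'"
  proof (rule continuous_on_blinfun_componentwise)
    fix i :: "real^'n"
    have "continuous_on U (\<lambda>x. frechet_derivative f (at x) i)"
      using smooth_on_frechet_derivative[OF assms(2)] by (rule smooth_on_imp_continuous_on)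
    then show "continuous_on U (\<lambda>x. blinfun_apply (f' x) i)"
      using f' by (simp cong: continuous_on_cong)
  qed
  obtain L where L: "linear L" "L \<circ> frechet_derivative f (at p) = id"
    using linear_injective_left_inverse[of "frechet_derivative f (at p)"] assms
      smooth_on_linear_frechet_derivative by blast
  have "Blinfun L o\<^sub>L f' p = id_blinfun"
    using L f'[OF \<open>p \<in> U\<close>]
    by (intro blinfun_eqI)
      (simp add: bounded_linear_Blinfun_apply linear_conv_bounded_linear fun_eq_iff)
  then obtain V W g g' where *: "open V" "V \<subseteq> U" "p \<in> V" "open W" "homeomorphism V W f g"
    and g: "\<And>y. y \<in> W \<Longrightarrow> (g has_derivative g' y) (at y)"
      "\<And>y. y \<in> W \<Longrightarrow> g' y = inv (blinfun_apply (f' (g y)))"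
      "\<And>y. y \<in> W \<Longrightarrow> bij (blinfun_apply (f' (g y)))"
    using inverse_function_theorem[OF \<open>open U\<close> _ cont \<open>p \<in> U\<close>, of f "Blinfun L"]
      f' smooth_on_has_derivative[OF assms(2)] by metis
  have gV: "g ` W \<subseteq> V" "g ` W \<subseteq> U"
    using *(2) homeomorphism_image2[OF *(5)] by auto
  define A where "A y = matrix (frechet_derivative f (at (g y)))" for y
  have A: "frechet_derivative f (at (g y)) = (*v) (A y)" if "y \<in> W" for y
    unfolding A_def
    using smooth_on_linear_frechet_derivative[OF assms(2), of "g y"] gV that matrix_works by fastforce
  have detA: "det (A y) \<noteq> 0" if "y \<in> W" for y
  proof -
    have "inj ((*v) (A y))"
      using g(3)[OF that] f'[of "g y"] gV that A[OF that] by (auto simp: bij_def)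
    then show ?thesis
      by (metis invertible_det_nz matrix_left_invertible_injective invertible_left_inverse)
  qed
  \<comment> \<open>Cramer's rule turns the inverse matrix into a quotient of polynomials in the
    entries of \<open>A y\<close>, which the \<open>Ck_on\<close> rules can handle.\<close>
  have g'_eq: "g' y v $ k = det (\<chi> i j. if j = k then v $ i else A y $ i $ j) / det (A y)"
    if "y \<in> W" for y v k
  proof -
    have "A y *v g' y v = v"
      using g(2,3)[OF that] f'[of "g y"] gV that A[OF that]
      by (metis bij_is_surj image_subset_iff surj_f_inv_f)
    then show ?thesis
      using cramer[OF detA[OF that], of "g' y v" v] by simp
  qed
  have "Ck_on k g W" for k
  proof (induction k)
    case 0
    then show ?case using homeomorphism_cont2[OF *(5)] by simp
  next
    case (Suc k)
    have cA: "Ck_on k (\<lambda>y. A y $ i $ j) W" for i j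
    proof -
      have "Ck_on k (\<lambda>y. frechet_derivative f (at (g y)) (axis j 1)) W"
        by (rule Ck_on_compose[OF \<open>open W\<close> \<open>open U\<close> gV(2) Suc.IH])
          (use Ck_on_SucD(2) smooth_onD[OF assms(2)] in blast)
      then have "Ck_on k (\<lambda>y. frechet_derivative f (at (g y)) (axis j 1) $ i) W"
        by (rule Ck_on_vec_nth[OF \<open>open W\<close>])
      then show ?thesis
        unfolding A_def matrix_def by simp
    qed
    show ?case
    proof (rule Ck_on_SucI[OF \<open>open W\<close> g(1)])
      fix v
      have "Ck_on k (\<lambda>y. g' y v $ l) W" for l
      proof (rule Ck_on_cong[OF \<open>open W\<close>])
        show "Ck_on k (\<lambda>y. det (\<chi> i j. if j = l then v $ i else A y $ i $ j) / det (A y)) W"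
        proof (intro Ck_on_divide[OF \<open>open W\<close>] Ck_on_det[OF \<open>open W\<close>] cA detA)
          fix i j
          show "Ck_on k (\<lambda>x. (\<chi> i j. if j = l then v $ i else A x $ i $ j) $ i $ j) W"
            using cA by (cases "j = l") (simp_all add: Ck_on_const)
        qed
      qed (simp add: g'_eq)
      then show "Ck_on k (\<lambda>y. g' y v) W"
        using Ck_on_vec[OF \<open>open W\<close>] by blast
    qed
  qed
  then have "diffeomorphism V W f g"
    unfolding diffeomorphism_def using * smooth_on_subset[OF assms(2) \<open>V \<subseteq> U\<close>] by (auto simp: smooth_on_def)
  with * show thesis by (intro that) auto
qed

subsection \<open>Coordinate charts\<close>

text \<open>Stands for R^K inside the fixed space, so that lowering the dimension means removing an
  index from \<open>K\<close>.\<close>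

definition coords :: "'n set \<Rightarrow> (real^'n::finite) set" where
  "coords K = {x. \<forall>i. i \<notin> K \<longrightarrow> x $ i = 0}"

lemma coordsI: "(\<And>i. i \<notin> K \<Longrightarrow> x $ i = 0) \<Longrightarrow> x \<in> coords K"
  and coordsD: "x \<in> coords K \<Longrightarrow> i \<notin> K \<Longrightarrow> x $ i = 0"
  by (auto simp: coords_def)

lemma subspace_coords: "subspace (coords K)"
  by (auto simp: subspace_def coords_def)

lemma closed_coords:
  fixes K :: "'n::finite set"
  shows "closed (coords K)"
proof -
  have "closed (\<Inter>i\<in>-K. {x::real^'n. x $ i = 0})"
    by (intro closed_INT ballI closed_Collect_eq continuous_intros)
  moreover have "coords K = (\<Inter>i\<in>-K. {x::real^'n. x $ i = 0})"
    by (auto simp: coords_def)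
  ultimately show ?thesis by simp
qed

lemma axis_in_coords: "l \<in> K \<Longrightarrow> axis l c \<in> coords K"
  by (auto simp: coords_def axis_def)

lemma linear_coords_expand:
  assumes "linear L" "u \<in> coords K"
  shows "L u = (\<Sum>i\<in>K. u $ i *\<^sub>R L (axis i 1))"
proof -
  have "L u = (\<Sum>i\<in>UNIV. u $ i *\<^sub>R L (axis i 1))"
    by (rule linear_vec_expand[OF assms(1)])
  also have "\<dots> = (\<Sum>i\<in>K. u $ i *\<^sub>R L (axis i 1))"
    using coordsD[OF assms(2)] by (intro sum.mono_neutral_right) auto
  finally show ?thesis .
qed

text \<open>Replacing coordinate \<open>l\<close> of \<open>x\<close> by \<open>w x\<close> has an
  injective derivative at \<open>p\<close> because the \<open>l\<close>-th partial of
  \<open>w\<close> is nonzero there. The local inverse \<open>\<psi>\<close> makes \<open>w\<close>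
  the coordinate \<open>l\<close> and changes no other coordinate, so for \<open>l\<close> in
  \<open>K\<close> it respects \<open>coords K\<close>.\<close>

lemma coordinate_chart:
  fixes w :: "real^'n::finite \<Rightarrow> real"
  assumes "open U" "smooth_on w U" "p \<in> U" "frechet_derivative w (at p) (axis l 1) \<noteq> 0"
  obtains V W \<psi> where "p \<in> V" "V \<subseteq> U" "open V" "open W" "smooth_on \<psi> W" "\<psi> ` W = V"
    "\<forall>x\<in>V. (\<chi> i. if i = l then w x else x $ i) \<in> W"
    "\<forall>x\<in>V. \<psi> (\<chi> i. if i = l then w x else x $ i) = x"
    "\<forall>y\<in>W. w (\<psi> y) = y $ l"
    "\<forall>y\<in>W. \<forall>i. i \<noteq> l \<longrightarrow> \<psi> y $ i = y $ i"
proof -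
  define h where "h x = (\<chi> i. if i = l then w x else x $ i)" for x
  have h: "smooth_on h U"
    unfolding smooth_on_vec[OF assms(1)]
  proof
    fix i show "smooth_on (\<lambda>x. h x $ i) U"
      using assms(2) smooth_on_vec_nth[OF assms(1)] by (cases "i = l") (simp_all add: h_def)
  qed
  have Dh: "frechet_derivative h (at p) u $ i = (if i = l then frechet_derivative w (at p) u else u $ i)"
    for u i
  proof -
    have "frechet_derivative (\<lambda>x::real^'n. x $ i) (at p) u = u $ i"
      using frechet_derivative_at[OF bounded_linear_imp_has_derivative[OF bounded_linear_vec_nth]] by metis
    then show ?thesis
      using frechet_derivative_vec_nth[OF h assms(3), of i u]
      by (cases "i = l") (simp_all add: h_def)
  qed
  have "inj (frechet_derivative h (at p))"
  proof (rule linear_injective_0[THEN iffD2, rule_format])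
    show "linear (frechet_derivative h (at p))"
      using smooth_on_linear_frechet_derivative[OF h assms(3)] .
    fix u assume "frechet_derivative h (at p) u = 0"
    then have *: "(if i = l then frechet_derivative w (at p) u else u $ i) = 0" for i
      using Dh[of u i] by simp
    have "u \<in> coords {l}"
      using * by (metis coordsI singletonI)
    then have "u $ l * frechet_derivative w (at p) (axis l 1) = 0"
      using linear_coords_expand[OF smooth_on_linear_frechet_derivative[OF assms(2,3)], of u "{l}"]
        *[of l] by simp
    then have "u $ i = 0" for i
      using * assms(4) by (metis mult_eq_0_iff)
    then show "u = 0"
      by (simp add: vec_eq_iff)
  qed
  then obtain V W g where *: "p \<in> V" "V \<subseteq> U" "diffeomorphism V W h g"
    using smooth_local_diffeomorphism[OF assms(1) h assms(3)] by blast
  then have **: "open V" "open W" "homeomorphism V W h g" "smooth_on g W"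
    by (auto simp: diffeomorphism_def)
  have hg: "h (g y) = y" if "y \<in> W" for y
    using **(3) that by (auto simp: homeomorphism_def)
  show thesis
  proof (rule that[of V W g])
    show "g ` W = V"
      using **(3) by (simp add: homeomorphism_def)
    show "\<forall>x\<in>V. (\<chi> i. if i = l then w x else x $ i) \<in> W" "\<forall>x\<in>V. g (\<chi> i. if i = l then w x else x $ i) = x"
      using **(3) by (auto simp: homeomorphism_def h_def)
    have hg': "(if i = l then w (g y) else g y $ i) = y $ i" if "y \<in> W" for y i
      using arg_cong[OF hg[OF that], of "\<lambda>z. z $ i"] by (simp add: h_def)
    show "\<forall>y\<in>W. w (g y) = y $ l"
      using hg'[of _ l] by simp
    show "\<forall>y\<in>W. \<forall>i. i \<noteq> l \<longrightarrow> g y $ i = y $ i"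
      using hg' by metis
  qed (use * ** in auto)
qed

text \<open>Each component of \<open>\<psi>\<close> outside \<open>K\<close> is a coordinate
  function near \<open>y\<close>, so the derivative leaves the zero components of \<open>u\<close>
  there unchanged. This keeps directions inside \<open>coords K\<close> when criticality is pulled
  back along a chart.\<close>

lemma frechet_derivative_coords:
  fixes \<psi> :: "real^'n::finite \<Rightarrow> real^'n"
  assumes "open W" "smooth_on \<psi> W" "\<And>y i. y \<in> W \<Longrightarrow> i \<notin> K \<Longrightarrow> \<psi> y $ i = y $ i" "y \<in> W" "u \<in> coords K"
  shows "frechet_derivative \<psi> (at y) u \<in> coords K"
proof (rule coordsI)
  fix i assume "i \<notin> K"
  have lin: "((\<lambda>y::real^'n. y $ i) has_derivative (\<lambda>y. y $ i)) (at y)"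
    by (rule bounded_linear_imp_has_derivative[OF bounded_linear_vec_nth])
  have "((\<lambda>y. \<psi> y $ i) has_derivative (\<lambda>y. y $ i)) (at y)"
    by (rule has_derivative_transform_within_open[OF lin assms(1,4)]) (simp add: assms(3) \<open>i \<notin> K\<close>)
  then have "frechet_derivative (\<lambda>y. \<psi> y $ i) (at y) u = u $ i"
    using frechet_derivative_at by metis
  then show "frechet_derivative \<psi> (at y) u $ i = 0"
    using frechet_derivative_vec_nth[OF assms(2,4)] coordsD[OF assms(5) \<open>i \<notin> K\<close>] by simp
qed

text \<open>By the Lindelof property countably many of the open sets \<open>T\<close> suffice.
  \<open>H\<close> is set-valued so that the lemma serves both images of points and cylinders over
  them.\<close>

lemma negligible_UN_local:
  fixes H :: "'a::second_countable_topology \<Rightarrow> 'b::euclidean_space set"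
  assumes "\<And>x. x \<in> S \<Longrightarrow> \<exists>T. open T \<and> x \<in> T \<and> negligible (\<Union>y\<in>S \<inter> T. H y)"
  shows "negligible (\<Union>y\<in>S. H y)"
proof -
  obtain T where T: "\<And>x. x \<in> S \<Longrightarrow> open (T x) \<and> x \<in> T x \<and> negligible (\<Union>y\<in>S \<inter> T x. H y)"
    using assms by metis
  obtain \<F> where \<F>: "\<F> \<subseteq> T ` S" "countable \<F>" "\<Union>\<F> = \<Union>(T ` S)"
    using Lindelof[of "T ` S"] T by blast
  have "negligible (\<Union>((\<lambda>B. \<Union>y\<in>S \<inter> B. H y) ` \<F>))"
    using \<F> T by (intro negligible_countable_Union) auto
  moreover have "(\<Union>y\<in>S. H y) \<subseteq> \<Union>((\<lambda>B. \<Union>y\<in>S \<inter> B. H y) ` \<F>)"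
    using \<F>(3) T by blast
  ultimately show ?thesis
    using negligible_subset by blast
qed

subsection \<open>Flat points\<close>

text \<open>The head of the list is the variable differentiated last, so removing it from
  \<open>l # ls\<close> leaves the function whose \<open>l\<close>-th partial is taken.\<close>

primrec partials :: "'n list \<Rightarrow> (real^'n::finite \<Rightarrow> real) \<Rightarrow> real^'n \<Rightarrow> real" where
  "partials [] g = g"
| "partials (l # ls) g = (\<lambda>x. frechet_derivative (partials ls g) (at x) (axis l 1))"

lemma partials_append: "partials (ls @ ms) g = partials ls (partials ms g)"
  by (induction ls) auto

lemma smooth_on_partials: "smooth_on g U \<Longrightarrow> smooth_on (partials ls g) U"
  by (induction ls) (auto intro: smooth_on_frechet_derivative)

text \<open>Critical points of infinite order of the restriction to \<open>coords K\<close>. The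
  empty list is excluded because the value of \<open>g\<close> itself is unconstrained.\<close>

definition flat_points :: "'n set \<Rightarrow> (real^'n::finite \<Rightarrow> real) \<Rightarrow> (real^'n) set \<Rightarrow> (real^'n) set" where
  "flat_points K g U = {x \<in> U \<inter> coords K. \<forall>ls. set ls \<subseteq> K \<longrightarrow> ls \<noteq> [] \<longrightarrow> partials ls g x = 0}"

lemma flat_points_partials:
  assumes "l \<in> K"
  shows "flat_points K g U \<subseteq> flat_points K (partials [l] g) U"
  using assms by (auto simp: flat_points_def simp flip: partials_append simp del: partials.simps)

text \<open>Induction on \<open>k\<close> with the mean value theorem on the segment from
  \<open>x\<close> to \<open>y\<close>: the increment of \<open>g\<close> is a combination of first
  partials at an intermediate point with coefficients at most \<open>norm (y - x)\<close>. These
  partials vanish at \<open>x\<close> and are flat there, so the induction hypothesis bounds them by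
  the power \<open>k\<close>. For \<open>k = 0\<close>, \<open>g\<close> is bounded on the compact
  set \<open>S\<close>.\<close>

lemma flat_points_Taylor:
  fixes g :: "real^'n::finite \<Rightarrow> real"
  assumes "open U" "smooth_on g U" "compact S" "convex S" "S \<subseteq> U"
  shows "\<exists>c\<ge>0. \<forall>x\<in>flat_points K g U \<inter> S. \<forall>y\<in>coords K \<inter> S. \<bar>g y - g x\<bar> \<le> c * norm (y - x) ^ k"
  using assms(2)
proof (induction k arbitrary: g)
  case 0
  have "bounded (g ` S)"
    using smooth_on_imp_continuous_on[OF 0] assms
    by (intro compact_imp_bounded compact_continuous_image) (auto intro: continuous_on_subset)
  then obtain M where M: "\<And>x. x \<in> S \<Longrightarrow> \<bar>g x\<bar> \<le> M"
    by (auto simp: bounded_iff)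
  have "\<bar>g y - g x\<bar> \<le> \<bar>2 * M\<bar>" if "x \<in> S" "y \<in> S" for x y
    using M[OF that(1)] M[OF that(2)] by linarith
  then show ?case
    by (intro exI[of _ "\<bar>2 * M\<bar>"]) auto
next
  case (Suc k)
  have "\<forall>l. \<exists>c\<ge>0. \<forall>x\<in>flat_points K (partials [l] g) U \<inter> S. \<forall>y\<in>coords K \<inter> S.
      \<bar>partials [l] g y - partials [l] g x\<bar> \<le> c * norm (y - x) ^ k"
    using Suc.IH smooth_on_partials[OF Suc.prems] by blast
  then obtain c where c0: "\<And>l. c l \<ge> 0" and c: "\<And>l x y. x \<in> flat_points K (partials [l] g) U \<inter> S \<Longrightarrow>
      y \<in> coords K \<inter> S \<Longrightarrow> \<bar>partials [l] g y - partials [l] g x\<bar> \<le> c l * norm (y - x) ^ k"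
    by metis
  show ?case
  proof (intro exI conjI ballI)
    show "(\<Sum>l\<in>K. c l) \<ge> 0"
      using c0 by (simp add: sum_nonneg)
    fix x y assume x: "x \<in> flat_points K g U \<inter> S" and y: "y \<in> coords K \<inter> S"
    have xK: "x \<in> coords K"
      using x by (simp add: flat_points_def)
    have yxK: "y - x \<in> coords K"
      using xK y subspace_diff[OF subspace_coords] by blast
    define z where "z t = x + t *\<^sub>R (y - x)" for t :: real
    have zS: "z t \<in> S" "z t \<in> coords K" if "t \<in> {0..1}" for t
    proof -
      have "z t = (1 - t) *\<^sub>R x + t *\<^sub>R y"
        by (simp add: z_def algebra_simps)
      then show "z t \<in> S"
        using x y that convexD_alt[OF \<open>convex S\<close>, of x y t] by simp
      show "z t \<in> coords K"
        unfolding z_def using xK yxK subspace_add[OF subspace_coords] subspace_scale[OF subspace_coords] by blast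
    qed
    have "((\<lambda>t. g (z t)) has_derivative (\<lambda>s. frechet_derivative g (at (z t)) (s *\<^sub>R (y - x)))) (at t within {0..1})"
      if "t \<in> {0..1}" for t
    proof (rule has_derivative_compose[where g=g])
      show "(z has_derivative (\<lambda>s. s *\<^sub>R (y - x))) (at t within {0..1})"
        unfolding z_def by (auto intro!: derivative_eq_intros)
      show "(g has_derivative frechet_derivative g (at (z t))) (at (z t))"
        using smooth_on_has_derivative[OF Suc.prems] zS(1)[OF that] assms(5) by blast
    qed
    from mvt_simple[of 0 1 "\<lambda>t. g (z t)", OF _ this] obtain t where t: "t \<in> {0<..<1}"
      "g y - g x = frechet_derivative g (at (z t)) (y - x)"
      by (auto simp: z_def)
    then have t1: "t \<in> {0..1}" by auto
    have part: "\<bar>partials [l] g (z t)\<bar> \<le> c l * norm (y - x) ^ k" if "l \<in> K" for l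
    proof -
      have "partials [l] g x = 0"
        using x \<open>l \<in> K\<close> unfolding flat_points_def by (auto simp del: partials.simps)
      then have "\<bar>partials [l] g (z t)\<bar> \<le> c l * norm (z t - x) ^ k"
        using c[of x l "z t"] x zS[OF t1] flat_points_partials[OF that, of g U] by fastforce
      also have "\<dots> \<le> c l * norm (y - x) ^ k"
        using t1 c0 by (intro mult_left_mono power_mono) (auto simp: z_def intro: mult_left_le_one_le)
      finally show ?thesis .
    qed
    have "z t \<in> U"
      using zS(1)[OF t1] assms(5) by blast
    then have "g y - g x = (\<Sum>l\<in>K. (y - x) $ l * partials [l] g (z t))"
      using linear_coords_expand[OF smooth_on_linear_frechet_derivative[OF Suc.prems] yxK] t(2) by simp
    also have "\<bar>\<dots>\<bar> \<le> (\<Sum>l\<in>K. norm (y - x) * (c l * norm (y - x) ^ k))"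
      by (intro sum_abs[THEN order_trans] sum_mono)
        (auto simp: abs_mult simp del: partials.simps vector_minus_component intro!: mult_mono component_le_norm_cart part)
    also have "\<dots> = (\<Sum>l\<in>K. c l) * norm (y - x) ^ Suc k"
      by (simp add: sum_distrib_right sum_distrib_left mult_ac)
    finally show "\<bar>g y - g x\<bar> \<le> (\<Sum>l\<in>K. c l) * norm (y - x) ^ Suc k" .
  qed
qed

text \<open>Let N be the dimension. A grid of mesh 1/n has O(n^N) cells meeting \<open>A\<close>,
  and the image of each has diameter O(n^-(N+1)), so the image of \<open>A\<close> is covered by
  intervals of total length O(1/n).\<close>

lemma negligible_image_Hoelder:
  fixes g :: "real^'n::finite \<Rightarrow> real"
  assumes "bounded A" "0 \<le> c"
    and g: "\<And>x y. x \<in> A \<Longrightarrow> y \<in> A \<Longrightarrow> \<bar>g y - g x\<bar> \<le> c * norm (y - x) ^ Suc CARD('n)"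
  shows "negligible (g ` A)"
  unfolding negligible_outer_le
proof (intro allI impI)
  fix e :: real assume "e > 0"
  obtain M0 where M0: "\<And>x. x \<in> A \<Longrightarrow> norm x \<le> M0"
    using assms(1) by (auto simp: bounded_iff)
  \<comment> \<open>The successor ensures \<open>M\<close> is at least 1, which later absorbs the
    extra 1 in the cell count: 2nM + 1 is at most 3Mn.\<close>
  define M where "M = Suc (nat \<lceil>M0\<rceil>)"
  have M: "\<bar>x $ i\<bar> \<le> real M" if "x \<in> A" for x i
    using M0[OF that] component_le_norm_cart[of x i] unfolding M_def by linarith
  let ?N = "CARD('n)"
  \<comment> \<open>Chosen so that (3Mn)^N cells, each with an image interval of length
    \<open>2 * \<delta>\<close>, give total length \<open>C / n\<close>; here
    \<open>\<delta>\<close> is the Hoelder bound for two points of one cell, whose distance is at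
    most N/n.\<close>
  define C where "C = (3 * real M) ^ ?N * (2 * (c * real ?N ^ Suc ?N))"
  obtain n :: nat where n: "n > 0" "C / real n \<le> e"
  proof -
    obtain n :: nat where "real n > C / e" "n > 0"
      using reals_Archimedean2[of "max (C / e) 1"] by force
    then show thesis
      using that[of n] \<open>e > 0\<close> by (simp add: field_simps)
  qed
  define q where "q x i = \<lfloor>real n * x $ i\<rfloor>" for x :: "real^'n" and i
  define Q where "Q = (\<Pi>\<^sub>E i\<in>(UNIV::'n set). {- int (n * M)..int (n * M)})"
  have q: "q x \<in> Q" if "x \<in> A" for x
  proof -
    have "\<bar>real n * x $ i\<bar> \<le> real (n * M)" for i
      using M[OF that, of i] by (simp add: abs_mult mult_left_mono)
    then have "- int (n * M) \<le> q x i \<and> q x i \<le> int (n * M)" for i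
      unfolding q_def by (smt (verit) floor_le_iff le_floor_iff of_int_minus of_int_of_nat_eq)
    then show ?thesis by (auto simp: Q_def)
  qed
  have finQ: "finite Q"
    unfolding Q_def by (intro finite_PiE) auto
  have "real (card Q) = (2 * real n * real M + 1) ^ ?N"
    by (simp add: Q_def card_PiE nat_add_distrib nat_mult_distrib algebra_simps)
  also have "\<dots> \<le> (3 * real M * real n) ^ ?N"
  proof (intro power_mono)
    have "1 \<le> M * n"
      using n(1) by (simp add: M_def)
    then have "real 1 \<le> real (M * n)"
      by (simp only: of_nat_le_iff)
    then show "2 * real n * real M + 1 \<le> 3 * real M * real n"
      by (simp add: algebra_simps)
  qed auto
  finally have cardQ: "real (card Q) \<le> (3 * real M * real n) ^ ?N" .
  define \<delta> where "\<delta> = c * (real ?N / real n) ^ Suc ?N"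
  have \<delta>: "\<bar>g y - g x\<bar> \<le> \<delta>" if "x \<in> A" "y \<in> A" "q x = q y" for x y
  proof -
    have "\<bar>(y - x) $ i\<bar> \<le> 1 / real n" for i
    proof -
      have "\<bar>real n * y $ i - real n * x $ i\<bar> \<le> 1"
        using fun_cong[OF that(3), of i] unfolding q_def by linarith
      moreover have "\<bar>real n * y $ i - real n * x $ i\<bar> = \<bar>(y - x) $ i\<bar> * real n"
        by (simp add: abs_mult flip: right_diff_distrib)
      ultimately show ?thesis
        using n(1) by (simp add: pos_le_divide_eq)
    qed
    then have "norm (y - x) \<le> (\<Sum>i\<in>(UNIV::'n set). 1 / real n)"
      by (intro norm_le_l1_cart[THEN order_trans] sum_mono) auto
    then have "norm (y - x) \<le> real ?N / real n" by simp
    then have "norm (y - x) ^ Suc ?N \<le> (real ?N / real n) ^ Suc ?N"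
      by (intro power_mono) auto
    then show ?thesis
      using g[OF that(1,2)] \<open>0 \<le> c\<close> unfolding \<delta>_def by (meson mult_left_mono order_trans)
  qed
  have "\<delta> \<ge> 0" unfolding \<delta>_def using \<open>0 \<le> c\<close> by simp
  define r where "r a = (SOME x. x \<in> A \<and> q x = a)" for a
  have r: "r (q x) \<in> A \<and> q (r (q x)) = q x" if "x \<in> A" for x
    unfolding r_def by (rule someI[of _ x]) (use that in auto)
  define T where "T = (\<Union>a\<in>Q. {g (r a) - \<delta>..g (r a) + \<delta>})"
  show "\<exists>T. g ` A \<subseteq> T \<and> T \<in> lmeasurable \<and> measure lebesgue T \<le> e"
  proof (intro exI conjI)
    show "g ` A \<subseteq> T"
    proof (rule image_subsetI)
      fix x assume "x \<in> A"
      then have "\<bar>g x - g (r (q x))\<bar> \<le> \<delta>"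
        using r[of x] \<delta>[of "r (q x)" x] by simp
      then show "g x \<in> T"
        using q[OF \<open>x \<in> A\<close>] unfolding T_def by (auto simp: abs_le_iff algebra_simps intro!: bexI[of _ "q x"])
    qed
    show "T \<in> lmeasurable"
      unfolding T_def using finQ by (intro fmeasurable.finite_UN) auto
    have "measure lebesgue T \<le> (\<Sum>a\<in>Q. measure lebesgue {g (r a) - \<delta>..g (r a) + \<delta>})"
      unfolding T_def by (intro measure_UNION_le finQ) auto
    also have "\<dots> = real (card Q) * (2 * \<delta>)"
      using \<open>\<delta> \<ge> 0\<close> by simp
    also have "\<dots> \<le> (3 * real M * real n) ^ ?N * (2 * \<delta>)"
      using cardQ \<open>\<delta> \<ge> 0\<close> by (intro mult_right_mono) auto
    also have "\<dots> = C / real n"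
      using n(1) by (simp add: C_def \<delta>_def power_mult_distrib power_divide field_simps)
    finally show "measure lebesgue T \<le> e"
      using n(2) by simp
  qed
qed

text \<open>Near each point the Taylor bound holds on a closed ball with exponent one more than the
  full dimension, whatever \<open>K\<close> is, and this is the exponent of the covering
  argument.\<close>

lemma negligible_flat_points_image:
  fixes g :: "real^'n::finite \<Rightarrow> real"
  assumes "open U" "smooth_on g U"
  shows "negligible (g ` flat_points K g U)"
proof -
  have "negligible (\<Union>x\<in>flat_points K g U. {g x})"
  proof (rule negligible_UN_local)
    fix x assume "x \<in> flat_points K g U"
    then have "x \<in> U" by (simp add: flat_points_def)
    then obtain r where r: "r > 0" "cball x r \<subseteq> U"
      using assms(1) open_contains_cball by blast
    obtain c where c: "c \<ge> 0" "\<And>x' y. x' \<in> flat_points K g U \<inter> cball x r \<Longrightarrow> y \<in> coords K \<inter> cball x r \<Longrightarrow>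
        \<bar>g y - g x'\<bar> \<le> c * norm (y - x') ^ Suc CARD('n)"
      using flat_points_Taylor[OF assms compact_cball convex_cball r(2)] by meson
    have "negligible (g ` (flat_points K g U \<inter> ball x r))"
      by (rule negligible_image_Hoelder[OF _ c(1)])
        (auto intro!: c(2) bounded_Int simp: flat_points_def less_imp_le simp del: power_Suc)
    then have "negligible (\<Union>y\<in>flat_points K g U \<inter> ball x r. {g y})"
      by (simp add: UNION_singleton_eq_range)
    then show "\<exists>T. open T \<and> x \<in> T \<and> negligible (\<Union>y\<in>flat_points K g U \<inter> T. {g y})"
      using r(1) by (intro exI[of _ "ball x r"]) auto
  qed
  then show ?thesis
    by (simp add: UNION_singleton_eq_range)
qed

subsection \<open>Sard's theorem for scalar functions\<close>

definition scalar_crit :: "'n set \<Rightarrow> (real^'n::finite \<Rightarrow> real) \<Rightarrow> (real^'n) set \<Rightarrow> (real^'n) set" where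
  "scalar_crit K g U = {x \<in> U \<inter> coords K. \<forall>u\<in>coords K. frechet_derivative g (at x) u = 0}"

text \<open>Induction on \<open>K\<close>. A critical point that is not flat is a zero of some
  iterated partial \<open>w\<close> with a nonzero \<open>l\<close>-th partial. With
  \<open>w\<close> as coordinate \<open>l\<close>, such points lie in the hyperplane where that
  coordinate is 0 and stay critical for \<open>g\<close> restricted to it, so the induction
  hypothesis for \<open>K - {l}\<close> applies. There are countably many pairs (\<open>ls\<close>,
  \<open>l\<close>), and the flat points have null image.\<close>

theorem scalar_Sard:
  fixes g :: "real^'n::finite \<Rightarrow> real"
  assumes "open U" "smooth_on g U"
  shows "negligible (g ` scalar_crit K g U)"
  using finite[of K] assms
proof (induction K arbitrary: U g rule: finite_psubset_induct)
  case (psubset K)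
  note U = \<open>open U\<close> and g = \<open>smooth_on g U\<close>
  define P where "P ls l = {x \<in> scalar_crit K g U. partials ls g x = 0 \<and> partials (l # ls) g x \<noteq> 0}" for ls l
  have neg: "negligible (g ` P ls l)" if "l \<in> K" for ls l
  proof -
    have "negligible (\<Union>x\<in>P ls l. {g x})"
    proof (rule negligible_UN_local)
      fix p assume p: "p \<in> P ls l"
      let ?w = "partials ls g"
      have pU: "p \<in> U" and dw: "frechet_derivative ?w (at p) (axis l 1) \<noteq> 0"
        using p by (auto simp: P_def scalar_crit_def)
      obtain V W \<psi> where \<psi>: "p \<in> V" "V \<subseteq> U" "open V" "open W" "smooth_on \<psi> W" "\<psi> ` W = V"
        "\<forall>x\<in>V. (\<chi> i. if i = l then ?w x else x $ i) \<in> W"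
        "\<forall>x\<in>V. \<psi> (\<chi> i. if i = l then ?w x else x $ i) = x"
        "\<forall>y\<in>W. ?w (\<psi> y) = y $ l"
        "\<forall>y\<in>W. \<forall>i. i \<noteq> l \<longrightarrow> \<psi> y $ i = y $ i"
        by (rule coordinate_chart[OF U smooth_on_partials[OF g] pU dw]) (rule that; assumption)
      have sm: "smooth_on (\<lambda>y. g (\<psi> y)) W"
        using \<psi>(2,6) by (intro smooth_on_compose[OF \<psi>(4) U _ \<psi>(5) g]) auto
      have "negligible ((\<lambda>y. g (\<psi> y)) ` scalar_crit (K - {l}) (\<lambda>y. g (\<psi> y)) W)"
        using \<open>l \<in> K\<close> by (intro psubset.IH \<psi>(4) sm) auto
      moreover have "(\<Union>x\<in>P ls l \<inter> V. {g x}) \<subseteq> (\<lambda>y. g (\<psi> y)) ` scalar_crit (K - {l}) (\<lambda>y. g (\<psi> y)) W"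
      proof clarify
        fix x assume x: "x \<in> P ls l" "x \<in> V"
        define y where "y = (\<chi> i. if i = l then ?w x else x $ i)"
        have y: "y \<in> W" "\<psi> y = x"
          using \<psi>(7,8) x(2) by (auto simp: y_def)
        have "x \<in> coords K" "?w x = 0" and dg: "\<And>u. u \<in> coords K \<Longrightarrow> frechet_derivative g (at x) u = 0"
          using x by (auto simp: P_def scalar_crit_def)
        \<comment> \<open>The new coordinate \<open>l\<close> of \<open>x\<close> is the value of
          \<open>w\<close>, which is zero on \<open>P ls l\<close>; this is what lowers the
          dimension.\<close>
        then have "y \<in> coords (K - {l})"
          by (auto simp: coords_def y_def)
        moreover have "frechet_derivative (\<lambda>y. g (\<psi> y)) (at y) u = 0" if "u \<in> coords (K - {l})" for u
        proof -
          have "u \<in> coords K"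
            using that by (auto simp: coords_def)
          then have "frechet_derivative \<psi> (at y) u \<in> coords K"
            using \<open>l \<in> K\<close> \<psi>(10) y(1) by (intro frechet_derivative_coords[OF \<psi>(4,5)]) auto
          then show ?thesis
            using frechet_derivative_comp[OF \<psi>(5) g y(1)] y(2) x(2) \<psi>(2) dg by auto
        qed
        ultimately have "y \<in> scalar_crit (K - {l}) (\<lambda>y. g (\<psi> y)) W"
          using y by (simp add: scalar_crit_def)
        then show "g x \<in> (\<lambda>y. g (\<psi> y)) ` scalar_crit (K - {l}) (\<lambda>y. g (\<psi> y)) W"
          using y(2) by force
      qed
      ultimately show "\<exists>T. open T \<and> p \<in> T \<and> negligible (\<Union>y\<in>P ls l \<inter> T. {g y})"
        using \<psi>(1,3) negligible_subset by blast
    qed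
    then show ?thesis
      by (simp add: UNION_singleton_eq_range)
  qed
  have sub: "scalar_crit K g U \<subseteq> flat_points K g U \<union> (\<Union>(ls, l)\<in>lists K \<times> K. P ls l)"
  proof
    fix x assume x: "x \<in> scalar_crit K g U"
    show "x \<in> flat_points K g U \<union> (\<Union>(ls, l)\<in>lists K \<times> K. P ls l)"
    proof (cases "x \<in> flat_points K g U")
      case False
      let ?Q = "\<lambda>ls. set ls \<subseteq> K \<and> ls \<noteq> [] \<and> partials ls g x \<noteq> 0"
      obtain ls0 where "?Q ls0"
        using False x by (auto simp: flat_points_def scalar_crit_def)
      \<comment> \<open>For a shortest list with nonvanishing partial, the tail is nonempty, since
        first partials vanish at a critical point, and its partial vanishes by minimality.\<close>
      then obtain ms where ms: "?Q ms" "\<And>ls. ?Q ls \<Longrightarrow> length ms \<le> length ls"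
        using ex_has_least_nat[of ?Q ls0 length] by blast
      then obtain l ls where lls: "ms = l # ls" by (cases ms) auto
      have "ls \<noteq> []"
        using ms(1) x by (auto simp: lls scalar_crit_def axis_in_coords)
      then have "partials ls g x = 0"
        using ms lls by fastforce
      then have "x \<in> P ls l" "ls \<in> lists K" "l \<in> K"
        using x ms(1) lls by (auto simp: P_def)
      then show ?thesis by blast
    qed auto
  qed
  have "negligible (\<Union>((\<lambda>(ls, l). g ` P ls l) ` (lists K \<times> K)))"
    using neg by (intro negligible_countable_Union countable_image countable_SIGMA countable_lists)
      (auto intro: countable_finite)
  then have "negligible (g ` flat_points K g U \<union> (\<Union>(ls, l)\<in>lists K \<times> K. g ` P ls l))"
    using negligible_flat_points_image[OF U g] by (simp add: negligible_Un)
  moreover have "g ` scalar_crit K g U \<subseteq> g ` flat_points K g U \<union> (\<Union>(ls, l)\<in>lists K \<times> K. g ` P ls l)"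
    using sub by fastforce
  ultimately show ?case
    using negligible_subset by blast
qed

subsection \<open>Sard's theorem for vector-valued maps\<close>

text \<open>Fubini with a redundant coordinate: instead of splitting off coordinate
  \<open>j\<close>, a real \<open>c\<close> is adjoined that overwrites it. The set \<open>X\<close>
  of pairs whose overwritten point lies in \<open>S\<close> has null slices for almost all
  \<open>c\<close>, hence is null, and a linear map carries it onto R x S.\<close>

lemma negligible_slices:
  fixes S :: "(real^'n::finite) set"
  assumes "S \<in> sets borel" "negligible N"
    and slice: "\<And>c. c \<notin> N \<Longrightarrow> negligible {y. (\<chi> i. if i = j then c else y $ i) \<in> S}"
  shows "negligible S"
proof -
  define upd where "upd c y = (\<chi> i. if i = j then c else y $ i)" for c and y :: "real^'n"
  have upd_lin: "linear (\<lambda>(c, y). upd c y)"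
    by (rule linearI) (auto simp: upd_def vec_eq_iff)
  have upd_cont: "continuous_on UNIV (\<lambda>(c, y). upd c y)"
    using upd_lin by (simp add: linear_continuous_on linear_conv_bounded_linear)
  define X where "X = (\<lambda>(c, y). upd c y) -` S"
  have X: "X \<in> sets borel"
    using borel_measurable_continuous_onI[OF upd_cont] assms(1) measurable_sets_borel unfolding X_def by blast
  have X': "X \<in> sets (lborel \<Otimes>\<^sub>M lborel)"
    unfolding lborel_prod using X by simp
  have "emeasure (lborel \<Otimes>\<^sub>M lborel) X = (\<integral>\<^sup>+c. emeasure lborel (Pair c -` X) \<partial>lborel)"
    by (rule lborel.emeasure_pair_measure_alt[OF X'])
  also have "\<dots> = (\<integral>\<^sup>+c. 0 \<partial>(lborel :: real measure))"
  proof (rule nn_integral_cong_AE)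
    have "AE c in lebesgue. c \<notin> N"
      using assms(2) by (auto simp: negligible_iff_null_sets intro: AE_not_in)
    then have "AE c in lborel. c \<notin> N"
      by (simp add: AE_completion_iff)
    then show "AE c in lborel. emeasure lborel (Pair c -` X) = 0"
    proof eventually_elim
      fix c assume "c \<notin> N"
      then have "negligible (Pair c -` X)"
        using slice[of c] by (simp add: X_def upd_def vimage_def)
      moreover have "Pair c -` X \<in> sets borel"
        using sets_Pair1[OF X'] by simp
      ultimately show "emeasure lborel (Pair c -` X) = 0"
        by (simp add: negligible_iff_emeasure0)
    qed
  qed
  finally have "emeasure lborel X = 0"
    by (simp add: lborel_prod)
  then have "negligible X"
    using X by (simp add: negligible_iff_emeasure0)
  \<comment> \<open>Exchanges the adjoined real with the coordinate \<open>j\<close>; it is a linear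
    involution, so the preimage of a point of R x S is obtained by applying it again.\<close>
  define \<theta> where "\<theta> = (\<lambda>(c, y). (y $ j, upd c y))"
  have "linear \<theta>"
    unfolding \<theta>_def by (rule linearI) (auto simp: upd_def vec_eq_iff)
  then have "\<theta> differentiable_on X"
    by (intro linear_imp_differentiable_on)
  then have "negligible (\<theta> ` X)"
    by (intro negligible_differentiable_image_negligible \<open>negligible X\<close>) auto
  moreover have "UNIV \<times> S \<subseteq> \<theta> ` X"
  proof clarify
    fix t z assume "z \<in> S"
    have "upd (z $ j) (upd t z) = z"
      by (simp add: upd_def vec_eq_iff)
    then have "(z $ j, upd t z) \<in> X" "\<theta> (z $ j, upd t z) = (t, z)"
      using \<open>z \<in> S\<close> by (auto simp: X_def \<theta>_def upd_def)
    then show "(t, z) \<in> \<theta> ` X" by force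
  qed
  ultimately have "negligible ((UNIV :: real set) \<times> S)"
    using negligible_subset by blast
  moreover have "(UNIV :: real set) \<times> S \<in> sets borel"
    using assms(1) by (intro borel_Times) auto
  ultimately have "emeasure lborel ((UNIV :: real set) \<times> S) = 0"
    by (simp add: negligible_iff_emeasure0)
  moreover have "emeasure (lborel \<Otimes>\<^sub>M lborel) ((UNIV :: real set) \<times> S)
      = emeasure lborel (UNIV :: real set) * emeasure lborel S"
    using assms(1) by (intro lborel.emeasure_pair_measure_Times) auto
  \<comment> \<open>The factor R has infinite measure, so the product can vanish only if the measure
    of \<open>S\<close> does.\<close>
  ultimately have "emeasure lborel S = 0"
    by (simp add: lborel_prod)
  then show ?thesis
    using assms(1) by (simp add: negligible_iff_emeasure0)
qed

text \<open>After enlarging \<open>T\<close> to a Borel null set, the slices at all \<open>c\<close>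
  outside it are empty.\<close>

lemma negligible_vec_nth_vimage:
  fixes T :: "real set"
  assumes "negligible T"
  shows "negligible {y :: real^'n::finite. y $ j \<in> T}"
proof -
  obtain N where N: "T \<subseteq> N" "N \<in> null_sets lborel"
    using assms by (auto simp: negligible_iff_null_sets null_sets_completion_iff2)
  then have "negligible N" "N \<in> sets borel"
    by (auto simp: negligible_iff_null_sets null_sets_completionI)
  have meas: "(\<lambda>y::real^'n. y $ j) \<in> borel_measurable borel"
    by (intro borel_measurable_continuous_onI continuous_intros)
  have "{y :: real^'n. y $ j \<in> N} \<in> sets borel"
    using measurable_sets_borel[OF meas \<open>N \<in> sets borel\<close>] by (simp add: vimage_def)
  then have "negligible {y :: real^'n. y $ j \<in> N}"
    by (rule negligible_slices[OF _ \<open>negligible N\<close>, of _ j]) simp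
  then show ?thesis
    by (rule negligible_subset) (use N in auto)
qed

text \<open>A map into \<open>\<real>\<^bsup>J\<^esup>\<close> is a family \<open>f\<close> of which only the members indexed by \<open>J\<close> matter. Nullity of
  a set of values in \<open>\<real>\<^bsup>J\<^esup>\<close> is expressed through the cylinder over it in the full space, so that the
  dimension can vary in inductions.\<close>

definition crit :: "'n set \<Rightarrow> 'n set \<Rightarrow> ('n \<Rightarrow> real^'n::finite \<Rightarrow> real) \<Rightarrow> (real^'n) set \<Rightarrow> (real^'n) set" where
  "crit K J f U = {x \<in> U \<inter> coords K. \<exists>v\<in>coords J. v \<noteq> 0 \<and>
     (\<forall>u\<in>coords K. (\<Sum>j\<in>J. v $ j * frechet_derivative (f j) (at x) u) = 0)}"

definition cylinder :: "'n set \<Rightarrow> ('n \<Rightarrow> real^'n::finite \<Rightarrow> real) \<Rightarrow> (real^'n) set \<Rightarrow> (real^'n) set" where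
  "cylinder J f A = (\<Union>x\<in>A. {y. \<forall>j\<in>J. y $ j = f j x})"

lemma cylinder_mono: "A \<subseteq> B \<Longrightarrow> cylinder J f A \<subseteq> cylinder J f B"
  by (auto simp: cylinder_def)

text \<open>Normalising the covector \<open>v\<close> to length 1 exhibits the critical points in
  \<open>C\<close> as the projection of a compact set of pairs (\<open>x\<close>, \<open>v\<close>);
  by linearity the vanishing condition is tested on the axes in \<open>K\<close>. The compactness
  supplies the Borel sets that slicing requires.\<close>

lemma compact_crit_Int:
  fixes f :: "'n::finite \<Rightarrow> real^'n \<Rightarrow> real"
  assumes "\<And>j. smooth_on (f j) U" "compact C" "C \<subseteq> U"
  shows "compact (crit K J f U \<inter> C)"
proof -
  define D where "D = (C \<inter> coords K) \<times> (sphere 0 1 \<inter> coords J)"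
  have D: "compact D"
    unfolding D_def using assms(2) closed_coords
    by (intro compact_Times compact_Int_closed compact_sphere) auto
  define h where "h l z = (\<Sum>j\<in>J. snd z $ j * frechet_derivative (f j) (at (fst z)) (axis l 1))"
    for l :: 'n and z :: "(real^'n) \<times> (real^'n)"
  have "continuous_on D (h l)" for l
  proof -
    have "continuous_on D (\<lambda>z. frechet_derivative (f j) (at (fst z)) (axis l 1))" for j
    proof (rule continuous_on_compose2[of U])
      show "continuous_on U (\<lambda>x. frechet_derivative (f j) (at x) (axis l 1))"
        by (intro smooth_on_imp_continuous_on smooth_on_frechet_derivative assms(1))
      show "fst ` D \<subseteq> U"
        using assms(3) by (auto simp: D_def)
    qed (intro continuous_intros)
    then show ?thesis
      unfolding h_def by (intro continuous_intros)
  qed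
  then have "closed {z \<in> D. h l z = 0}" for l
    using D compact_imp_closed by (intro continuous_closed_preimage_constant) auto
  then have "compact (D \<inter> (\<Inter>l\<in>K. {z \<in> D. h l z = 0}))"
    using D by (intro compact_Int_closed closed_INT) auto
  then have "compact (fst ` (D \<inter> (\<Inter>l\<in>K. {z \<in> D. h l z = 0})))"
    by (intro compact_continuous_image continuous_intros)
  moreover have "fst ` (D \<inter> (\<Inter>l\<in>K. {z \<in> D. h l z = 0})) = crit K J f U \<inter> C"
  proof (intro subset_antisym subsetI)
    fix x assume "x \<in> fst ` (D \<inter> (\<Inter>l\<in>K. {z \<in> D. h l z = 0}))"
    then obtain v where v: "(x, v) \<in> D" "\<And>l. l \<in> K \<Longrightarrow> h l (x, v) = 0"
      by auto
    have xC: "x \<in> C" "x \<in> U" "x \<in> coords K" "v \<in> coords J" "v \<noteq> 0"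
      using v(1) assms(3) by (auto simp: D_def)
    have "(\<Sum>j\<in>J. v $ j * frechet_derivative (f j) (at x) u) = 0" if "u \<in> coords K" for u
    proof -
      have "(\<Sum>j\<in>J. v $ j * frechet_derivative (f j) (at x) u)
          = (\<Sum>j\<in>J. v $ j * (\<Sum>l\<in>K. u $ l * frechet_derivative (f j) (at x) (axis l 1)))"
        using linear_coords_expand[OF smooth_on_linear_frechet_derivative[OF assms(1) xC(2)] that] by simp
      also have "\<dots> = (\<Sum>j\<in>J. \<Sum>l\<in>K. u $ l * (v $ j * frechet_derivative (f j) (at x) (axis l 1)))"
        by (simp add: sum_distrib_left mult_ac)
      also have "\<dots> = (\<Sum>l\<in>K. \<Sum>j\<in>J. u $ l * (v $ j * frechet_derivative (f j) (at x) (axis l 1)))"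
        by (rule sum.swap)
      also have "\<dots> = (\<Sum>l\<in>K. u $ l * h l (x, v))"
        by (simp add: h_def sum_distrib_left)
      finally show ?thesis using v(2) by simp
    qed
    then show "x \<in> crit K J f U \<inter> C"
      unfolding crit_def using xC by blast
  next
    fix x assume x: "x \<in> crit K J f U \<inter> C"
    then obtain v where v: "v \<in> coords J" "v \<noteq> 0" "x \<in> coords K"
      "\<And>u. u \<in> coords K \<Longrightarrow> (\<Sum>j\<in>J. v $ j * frechet_derivative (f j) (at x) u) = 0"
      by (auto simp: crit_def)
    let ?v = "inverse (norm v) *\<^sub>R v"
    have "(x, ?v) \<in> D"
      using x v subspace_scale[OF subspace_coords] by (auto simp: D_def)
    moreover have "h l (x, ?v) = 0" if "l \<in> K" for l
    proof -
      have "h l (x, ?v) = inverse (norm v) * (\<Sum>j\<in>J. v $ j * frechet_derivative (f j) (at x) (axis l 1))"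
        by (simp add: h_def sum_distrib_left mult_ac)
      then show ?thesis
        using v(4)[OF axis_in_coords[OF that]] by simp
    qed
    ultimately have "(x, ?v) \<in> D \<inter> (\<Inter>l\<in>K. {z \<in> D. h l z = 0})"
      by simp
    then show "x \<in> fst ` (D \<inter> (\<Inter>l\<in>K. {z \<in> D. h l z = 0}))"
      by force
  qed
  ultimately show ?thesis by simp
qed

text \<open>A cylinder is the sum of a compact set, the image of \<open>A\<close> with coordinates
  outside \<open>J\<close> set to 0, and the closed subspace \<open>coords (- J)\<close>.\<close>

lemma closed_cylinder:
  fixes f :: "'n::finite \<Rightarrow> real^'n \<Rightarrow> real"
  assumes "compact A" "\<And>j. continuous_on A (f j)"
  shows "closed (cylinder J f A)"
proof -
  define F where "F x = (\<chi> j. if j \<in> J then f j x else 0)" for x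
  have "continuous_on A (\<lambda>x. if j \<in> J then f j x else 0)" for j
    using assms(2) by (cases "j \<in> J") auto
  then have "continuous_on A F"
    unfolding F_def by (rule continuous_on_vec_lambda)
  then have "compact (F ` A)"
    using assms(1) by (rule compact_continuous_image)
  then have "closed (\<Union>a\<in>F ` A. \<Union>b\<in>coords (- J). {a + b})"
    using closed_coords by (rule compact_closed_sums)
  moreover have "(\<Union>a\<in>F ` A. \<Union>b\<in>coords (- J). {a + b}) = cylinder J f A"
  proof (intro subset_antisym subsetI)
    fix y assume "y \<in> cylinder J f A"
    then obtain x where x: "x \<in> A" "\<forall>j\<in>J. y $ j = f j x"
      by (auto simp: cylinder_def)
    then have "y - F x \<in> coords (- J)"
      by (auto simp: coords_def F_def)
    then show "y \<in> (\<Union>a\<in>F ` A. \<Union>b\<in>coords (- J). {a + b})"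
      using x(1) by (intro UN_I[of "F x"] UN_I[of "y - F x"]) auto
  qed (auto simp: cylinder_def coords_def F_def)
  ultimately show ?thesis by simp
qed

text \<open>Induction on \<open>J\<close>, with some \<open>j\<close> in \<open>J\<close> singled
  out. Where a partial of \<open>f j\<close> in a direction \<open>l\<close> of \<open>K\<close> is
  nonzero, \<open>f j\<close> becomes coordinate \<open>l\<close>; on each slice of constant
  \<open>f j\<close> the critical points are critical for the other components, and Fubini combines
  the slices. Elsewhere \<open>x\<close> is critical for the scalar \<open>f j\<close>, whose
  critical values are null.\<close>

theorem Sard_cylinder:
  fixes f :: "'n::finite \<Rightarrow> real^'n \<Rightarrow> real"
  assumes "open U" "\<And>j. smooth_on (f j) U"
  shows "negligible (cylinder J f (crit K J f U))"
  using finite[of J] assms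
proof (induction J arbitrary: K U f rule: finite_psubset_induct)
  case (psubset J)
  note U = \<open>open U\<close> and f = \<open>\<And>j. smooth_on (f j) U\<close>
  define P where "P j l = {x \<in> crit K J f U. frechet_derivative (f j) (at x) (axis l 1) \<noteq> 0}" for j l
  have neg: "negligible (cylinder J f (P j l))" if "j \<in> J" "l \<in> K" for j l
    unfolding cylinder_def
  proof (rule negligible_UN_local)
    fix p assume p: "p \<in> P j l"
    have pU: "p \<in> U" and df: "frechet_derivative (f j) (at p) (axis l 1) \<noteq> 0"
      using p by (auto simp: P_def crit_def)
    obtain V W \<psi> where \<psi>: "p \<in> V" "V \<subseteq> U" "open V" "open W" "smooth_on \<psi> W" "\<psi> ` W = V"
      "\<forall>x\<in>V. (\<chi> i. if i = l then f j x else x $ i) \<in> W"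
      "\<forall>x\<in>V. \<psi> (\<chi> i. if i = l then f j x else x $ i) = x"
      "\<forall>y\<in>W. f j (\<psi> y) = y $ l"
      "\<forall>y\<in>W. \<forall>i. i \<noteq> l \<longrightarrow> \<psi> y $ i = y $ i"
      by (rule coordinate_chart[OF U f pU df]) (rule that; assumption)
    \<comment> \<open>A closed ball inside \<open>V'\<close> keeps the partial derivative nonzero,
      so the whole compact piece \<open>A\<close> of the critical set can be treated;
      \<open>P j l\<close> itself need not be closed.\<close>
    define V' where "V' = V \<inter> {x \<in> U. frechet_derivative (f j) (at x) (axis l 1) \<noteq> 0}"
    have "open V'"
      unfolding V'_def using U \<psi>(3) smooth_on_imp_continuous_on[OF smooth_on_frechet_derivative[OF f]]
      by (intro open_Int continuous_open_preimage[of U _ "-{0}", simplified vimage_def Int_def, simplified])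
        auto
    moreover have "p \<in> V'"
      using \<psi>(1) pU df by (simp add: V'_def)
    ultimately obtain r where r: "r > 0" "cball p r \<subseteq> V'"
      using open_contains_cball by blast
    define A where "A = crit K J f U \<inter> cball p r"
    have AV: "A \<subseteq> V" "A \<subseteq> U" "\<And>x. x \<in> A \<Longrightarrow> frechet_derivative (f j) (at x) (axis l 1) \<noteq> 0"
      using r(2) by (auto simp: A_def V'_def)
    have "cball p r \<subseteq> U"
      using r(2) by (auto simp: V'_def)
    then have "compact A"
      unfolding A_def by (intro compact_crit_Int f compact_cball)
    then have "closed (cylinder J f A)"
      using AV(2) smooth_on_imp_continuous_on[OF f]
      by (intro closed_cylinder) (auto intro: continuous_on_subset)
    then have borel: "cylinder J f A \<in> sets borel"
      by simp
    have "negligible (cylinder J f A)"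
    proof (rule negligible_slices[OF borel negligible_empty, of j])
      fix c
      \<comment> \<open>Translation by \<open>a\<close> moves the slice where coordinate
        \<open>l\<close> equals \<open>c\<close> to the one where it is 0, which is the form
        \<open>coords (K - {l})\<close> expects.\<close>
      define a :: "real^'n" where "a = axis l c"
      define W' where "W' = (\<lambda>y. y + a) -` W"
      define f' where "f' i y = f i (\<psi> (y + a))" for i y
      have W': "open W'"
        unfolding W'_def by (intro open_vimage \<psi>(4) continuous_intros)
      have "smooth_on (\<lambda>y. y + a) W'"
        unfolding smooth_on_def
        using Ck_on_add[OF W' Ck_on_bounded_linear[OF W' bounded_linear_ident] Ck_on_const] by blast
      then have \<psi>': "smooth_on (\<lambda>y. \<psi> (y + a)) W'"
        by (intro smooth_on_compose[OF W' \<psi>(4) _ _ \<psi>(5)]) (auto simp: W'_def)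
      have f': "smooth_on (f' i) W'" for i
        unfolding f'_def using \<psi>(2,6)
        by (intro smooth_on_compose[OF W' U _ \<psi>' f]) (auto simp: W'_def)
      have "negligible (cylinder (J - {j}) f' (crit (K - {l}) (J - {j}) f' W'))"
        using \<open>j \<in> J\<close> by (intro psubset.IH W' f') auto
      moreover have "{y. (\<chi> i. if i = j then c else y $ i) \<in> cylinder J f A}
          \<subseteq> cylinder (J - {j}) f' (crit (K - {l}) (J - {j}) f' W')"
      proof clarify
        fix z assume "(\<chi> i. if i = j then c else z $ i) \<in> cylinder J f A"
        then obtain x where x: "x \<in> A" "\<And>i. i \<in> J \<Longrightarrow> (if i = j then c else z $ i) = f i x"
          by (auto simp: cylinder_def)
        have fj: "f j x = c"
          using x(2)[OF \<open>j \<in> J\<close>] by simp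
        have xV: "x \<in> V" "x \<in> U" "x \<in> coords K"
          using x(1) AV by (auto simp: A_def crit_def)
        define y where "y = (\<chi> i. if i = l then 0 else x $ i)"
        have "y + a = (\<chi> i. if i = l then f j x else x $ i)"
          by (simp add: vec_eq_iff y_def a_def axis_def fj)
        then have y: "y + a \<in> W" "\<psi> (y + a) = x"
          using \<psi>(7,8) xV(1) by auto
        have yW': "y \<in> W'"
          using y(1) by (simp add: W'_def)
        have f'y: "f' i y = f i x" for i
          using y(2) by (simp add: f'_def)
        obtain v where v: "v \<in> coords J" "v \<noteq> 0"
          "\<And>u. u \<in> coords K \<Longrightarrow> (\<Sum>i\<in>J. v $ i * frechet_derivative (f i) (at x) u) = 0"
          using x(1) by (auto simp: A_def crit_def)
        define v' where "v' = (\<chi> i. if i = j then 0 else v $ i)"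
        \<comment> \<open>Otherwise \<open>v\<close> is concentrated on \<open>j\<close>, and
          testing the relation on \<open>axis l 1\<close> contradicts the nonvanishing partial of
          \<open>f j\<close>.\<close>
        have "v' \<noteq> 0"
        proof
          assume "v' = 0"
          then have v0: "v $ i = 0" if "i \<noteq> j" for i
            using that by (metis (mono_tags, lifting) v'_def vec_lambda_beta zero_index)
          then have "(\<Sum>i\<in>J. v $ i * frechet_derivative (f i) (at x) (axis l 1))
              = (\<Sum>i\<in>{j}. v $ i * frechet_derivative (f i) (at x) (axis l 1))"
            using \<open>j \<in> J\<close> by (intro sum.mono_neutral_right) auto
          then have "v $ j = 0"
            using v(3)[OF axis_in_coords[OF \<open>l \<in> K\<close>]] AV(3)[OF x(1)] by simp
          then have "v = 0"
            using v0 by (metis vec_eq_iff zero_index)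
          then show False using v(2) by simp
        qed
        moreover have "v' \<in> coords (J - {j})"
          using v(1) by (auto simp: coords_def v'_def)
        moreover have "(\<Sum>i\<in>J - {j}. v' $ i * frechet_derivative (f' i) (at y) u) = 0"
          if u: "u \<in> coords (K - {l})" for u
        proof -
          define u' where "u' = frechet_derivative (\<lambda>y. \<psi> (y + a)) (at y) u"
          have "u \<in> coords K" "u $ l = 0"
            using u by (auto simp: coords_def)
          have Df': "frechet_derivative (f' i) (at y) u = frechet_derivative (f i) (at x) u'" for i
            unfolding f'_def u'_def using frechet_derivative_comp[OF \<psi>' f yW', of i u] y(2) xV(2) by simp
          have comp: "\<psi> (y + a) $ i = y $ i" if "y \<in> W'" "i \<notin> K" for y i
            using \<psi>(10)[rule_format, of "y + a" i] that \<open>l \<in> K\<close> by (auto simp: W'_def a_def axis_def)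
          have "u' \<in> coords K"
            unfolding u'_def by (rule frechet_derivative_coords[OF W' \<psi>' comp yW' \<open>u \<in> coords K\<close>])
          \<comment> \<open>In the translated chart \<open>f' j\<close> is coordinate
            \<open>l\<close> plus \<open>c\<close>, hence constant along directions with zero
            \<open>l\<close>-component. The \<open>j\<close>-th term of the relation therefore
            vanishes and may be dropped.\<close>
          have "((\<lambda>y::real^'n. y $ l + c) has_derivative (\<lambda>v. v $ l)) (at y)"
            by (rule has_derivative_eq_rhs, rule has_derivative_add[OF
                  bounded_linear_imp_has_derivative[OF bounded_linear_vec_nth] has_derivative_const]) simp
          then have "(f' j has_derivative (\<lambda>v. v $ l)) (at y)"
            using \<psi>(9)
            by (elim has_derivative_transform_within_open[OF _ W' yW']) (auto simp: W'_def f'_def a_def)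
          then have "frechet_derivative (f' j) (at y) u = 0"
            using \<open>u $ l = 0\<close> frechet_derivative_at by metis
          then have j0: "frechet_derivative (f j) (at x) u' = 0"
            using Df' by simp
          have "(\<Sum>i\<in>J - {j}. v' $ i * frechet_derivative (f' i) (at y) u)
              = (\<Sum>i\<in>J - {j}. v $ i * frechet_derivative (f i) (at x) u')"
            by (intro sum.cong) (auto simp: v'_def Df')
          also have "\<dots> = (\<Sum>i\<in>J. v $ i * frechet_derivative (f i) (at x) u')"
            using j0 by (intro sum.mono_neutral_left) auto
          finally show ?thesis
            using v(3)[OF \<open>u' \<in> coords K\<close>] by simp
        qed
        moreover have "y \<in> coords (K - {l})"
          using xV(3) by (auto simp: coords_def y_def)
        ultimately have "y \<in> crit (K - {l}) (J - {j}) f' W'"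
          unfolding crit_def using yW' by blast
        moreover have "\<forall>i\<in>J - {j}. z $ i = f' i y"
          using x(2) f'y by (metis Diff_iff singletonI)
        ultimately show "z \<in> cylinder (J - {j}) f' (crit (K - {l}) (J - {j}) f' W')"
          unfolding cylinder_def by blast
      qed
      ultimately show "negligible {y. (\<chi> i. if i = j then c else y $ i) \<in> cylinder J f A}"
        using negligible_subset by blast
    qed
    moreover have "cylinder J f (P j l \<inter> ball p r) \<subseteq> cylinder J f A"
      by (intro cylinder_mono) (auto simp: P_def A_def)
    ultimately have "negligible (\<Union>x\<in>P j l \<inter> ball p r. {y. \<forall>j\<in>J. y $ j = f j x})"
      unfolding cylinder_def by (rule negligible_subset)
    then show "\<exists>T. open T \<and> p \<in> T \<and> negligible (\<Union>x\<in>P j l \<inter> T. {y. \<forall>j\<in>J. y $ j = f j x})"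
      using r(1) by (intro exI[of _ "ball p r"]) auto
  qed
  show ?case
  proof (cases "J = {}")
    case True
    then have "crit K J f U = {}"
      by (auto simp: crit_def coords_def vec_eq_iff)
    then show ?thesis
      by (simp add: cylinder_def)
  next
    case False
    then obtain j where j: "j \<in> J" by blast
    have "negligible {y :: real^'n. y $ j \<in> f j ` scalar_crit K (f j) U}"
      by (intro negligible_vec_nth_vimage scalar_Sard U f)
    moreover have "negligible (\<Union>l\<in>K. cylinder J f (P j l))"
      using neg[OF j] by (intro negligible_countable_Union countable_image) (auto intro: countable_finite)
    moreover have "cylinder J f (crit K J f U) \<subseteq>
        {y. y $ j \<in> f j ` scalar_crit K (f j) U} \<union> (\<Union>l\<in>K. cylinder J f (P j l))"
    proof
      fix y assume "y \<in> cylinder J f (crit K J f U)"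
      then obtain x where x: "x \<in> crit K J f U" "\<forall>i\<in>J. y $ i = f i x"
        by (auto simp: cylinder_def)
      have xU: "x \<in> U" "x \<in> coords K"
        using x(1) by (auto simp: crit_def)
      show "y \<in> {y. y $ j \<in> f j ` scalar_crit K (f j) U} \<union> (\<Union>l\<in>K. cylinder J f (P j l))"
      proof (cases "\<exists>l\<in>K. x \<in> P j l")
        case True
        then show ?thesis using x(2) by (auto simp: cylinder_def)
      next
        case False
        then have "frechet_derivative (f j) (at x) (axis l 1) = 0" if "l \<in> K" for l
          using x(1) that by (auto simp: P_def)
        then have "frechet_derivative (f j) (at x) u = 0" if "u \<in> coords K" for u
          using linear_coords_expand[OF smooth_on_linear_frechet_derivative[OF f xU(1)] that] by simp
        then have "x \<in> scalar_crit K (f j) U"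
          using xU by (auto simp: scalar_crit_def)
        then show ?thesis using x(2) j by auto
      qed
    qed
    ultimately show ?thesis
      by (meson negligible_subset negligible_Un)
  qed
qed

subsection \<open>Charts at points of maximal rank\<close>

lemma diffeomorphism_restrict:
  assumes "diffeomorphism V W \<phi> \<psi>" "open W'" "W' \<subseteq> W"
  shows "diffeomorphism (\<psi> ` W') W' \<phi> \<psi>"
proof -
  have d: "open V" "homeomorphism V W \<phi> \<psi>" "smooth_on \<phi> V" "smooth_on \<psi> W"
    using assms(1) by (auto simp: diffeomorphism_def)
  have sub: "\<psi> ` W' \<subseteq> V"
    using d(2) assms(3) by (auto simp: homeomorphism_def)
  have eq: "\<psi> ` W' = V \<inter> \<phi> -` W'"
    using d(2) assms(3) unfolding homeomorphism_def by force
  have "open (\<psi> ` W')"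
    unfolding eq using homeomorphism_cont1[OF d(2)] d(1) assms(2) by (rule continuous_open_preimage)
  moreover have "homeomorphism (\<psi> ` W') W' \<phi> \<psi>"
  proof -
    have "\<phi> ` \<psi> ` W' = W'"
      using d(2) assms(3) unfolding homeomorphism_def by force
    then show ?thesis
      using homeomorphism_of_subsets[OF d(2) sub assms(3)] by simp
  qed
  ultimately show ?thesis
    unfolding diffeomorphism_def using d assms sub by (auto intro: smooth_on_subset)
qed

lemma jacobian_mult_vec:
  fixes F :: "real^'n::finite \<Rightarrow> real^'m::finite"
  assumes "smooth_on F U" "x \<in> U"
  shows "jacobian F (at x) *v u = frechet_derivative F (at x) u"
proof -
  have "(F has_derivative (\<lambda>h. jacobian F (at x) *v h)) (at x)"
    using smooth_on_has_derivative[OF assms] by (metis differentiable_def jacobian_works)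
  from has_derivative_unique[OF this smooth_on_has_derivative[OF assms]] show ?thesis
    by metis
qed

lemma rank_jacobian:
  fixes F :: "real^'n::finite \<Rightarrow> real^'m::finite"
  assumes "smooth_on F U" "x \<in> U"
  shows "rank (jacobian F (at x)) = dim (range (frechet_derivative F (at x)))"
  using jacobian_mult_vec[OF assms] by (simp add: rank_dim_range)

lemma dim_coords: "dim (coords J) = card J"
  using dim_substandard_cart[of J, where 'a=real] by (simp add: dim_vec_eq coords_def)

text \<open>A basis \<open>B\<close> of the row space, taken among the rows, is completed to a basis
  \<open>C\<close> of the whole space by standard basis vectors. A vector \<open>u\<close> killed by
  the selected rows and by the added coordinates is orthogonal to \<open>C\<close>, hence
  zero.\<close>

lemma exists_row_coordinates:
  fixes A :: "real^'n::finite^'m::finite"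
  obtains J :: "'n set" and \<sigma> :: "'n \<Rightarrow> 'm" where "card J = rank A"
    "\<forall>u. (\<forall>i\<in>J. (A *v u) $ \<sigma> i = 0) \<and> (\<forall>i. i \<notin> J \<longrightarrow> u $ i = 0) \<longrightarrow> u = 0"
proof -
  obtain B where B: "B \<subseteq> rows A" "independent B" "card B = rank A"
    using basis_exists[of "rows A"] unfolding row_rank_def by metis
  let ?E = "range (\<lambda>i. axis i (1::real)) :: (real^'n) set"
  obtain C where C: "B \<subseteq> C" "C \<subseteq> B \<union> ?E" "independent C" "B \<union> ?E \<subseteq> span C"
    using maximal_independent_subset_extend[of B "B \<union> ?E"] B(2) by auto
  have "u \<in> span ?E" for u :: "real^'n"
  proof -
    have "u = (\<Sum>i\<in>UNIV. u $ i *\<^sub>R axis i (1::real))"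
      using basis_expansion[of u] by (simp add: scalar_mult_eq_scaleR)
    also have "\<dots> \<in> span ?E"
      by (intro span_sum span_scale span_base) auto
    finally show ?thesis .
  qed
  then have spanC: "span C = UNIV"
    using C(4) span_mono[of ?E "span C"] by (auto simp: span_span)
  have fin: "finite C"
    using C(3) independent_imp_finite by blast
  have "card C = CARD('n)"
    using dim_span_eq_card_independent[OF C(3)] spanC by simp
  \<comment> \<open>The indices whose axis was not added; an axis already belonging to
    \<open>B\<close> counts as not added. Thus \<open>J\<close> has as many elements as
    \<open>B\<close>.\<close>
  define J where "J = {i::'n. axis i (1::real) \<notin> C - B}"
  have "(\<lambda>i. axis i (1::real)) ` (- J) = C - B"
    using C(2) by (auto simp: J_def)
  moreover have "inj_on (\<lambda>i::'n. axis i (1::real)) (- J)"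
    by (auto simp: inj_on_def axis_eq_axis)
  ultimately have "card (- J) = card (C - B)"
    by (metis card_image)
  then have cardJ: "card J = card B"
    using \<open>card C = CARD('n)\<close> fin C(1) card_mono[OF fin C(1)] card_mono[of UNIV J]
    by (simp add: card_Diff_subset finite_subset Compl_eq_Diff_UNIV)
  then obtain \<beta> where \<beta>: "bij_betw \<beta> J B"
    using finite_same_card_bij[of J B] fin C(1) finite_subset by auto
  define \<sigma> where "\<sigma> i = (SOME k. row k A = \<beta> i)" for i
  have \<sigma>: "row (\<sigma> i) A = \<beta> i" if "i \<in> J" for i
  proof -
    have "\<beta> i \<in> rows A"
      using \<beta> that B(1) by (auto simp: bij_betw_def)
    then show ?thesis
      unfolding \<sigma>_def rows_def by (auto intro: someI)
  qed
  show thesis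
  proof (rule that[of J \<sigma>], use cardJ B(3) in simp, intro allI impI)
    fix u :: "real^'n"
    assume u: "(\<forall>i\<in>J. (A *v u) $ \<sigma> i = 0) \<and> (\<forall>i. i \<notin> J \<longrightarrow> u $ i = 0)"
    have "orthogonal u c" if c: "c \<in> C" for c
    proof (cases "c \<in> B")
      case True
      then obtain i where "i \<in> J" "c = row (\<sigma> i) A"
        using \<beta> \<sigma> by (auto simp: bij_betw_def)
      then show ?thesis
        using u by (simp add: orthogonal_def matrix_vector_mul_component row_def inner_commute
            vec_lambda_eta)
    next
      case False
      then obtain i where i: "c = axis i 1"
        using C(2) c by auto
      then have "i \<notin> J"
        using False c by (simp add: J_def)
      then show ?thesis
        using u i by (simp add: orthogonal_def inner_axis)
    qed
    then have "orthogonal u u"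
      using orthogonal_to_span[of u C u] spanC by simp
    then show "u = 0"
      by (simp add: orthogonal_def)
  qed
qed

text \<open>The constant rank theorem at a point of maximal rank. The components
  \<open>\<sigma> j\<close> of \<open>F\<close>, shifted to vanish at \<open>p\<close>, together
  with the coordinates outside \<open>J\<close> form a chart; in it \<open>F\<close> depends only on
  the coordinates in \<open>J\<close>.\<close>

lemma max_rank_chart:
  fixes F :: "real^'n::finite \<Rightarrow> real^'m::finite"
  assumes "open U" "smooth_on F U" "p \<in> U"
    and max: "\<forall>x\<in>U. rank (jacobian F (at x)) \<le> rank (jacobian F (at p))"
  obtains J :: "'n set" and \<sigma> :: "'n \<Rightarrow> 'm" and V W :: "(real^'n) set"
    and \<phi> \<psi> :: "real^'n \<Rightarrow> real^'n" where "card J = rank (jacobian F (at p))"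
    "p \<in> V" "V \<subseteq> U" "diffeomorphism V W \<phi> \<psi>"
    "\<forall>x\<in>V. \<forall>j\<in>J. \<phi> x $ j = F x $ \<sigma> j - F p $ \<sigma> j"
    "\<forall>x\<in>V. rank (jacobian F (at x)) = rank (jacobian F (at p))"
    "\<forall>x\<in>V. \<forall>x'\<in>V. (\<forall>j\<in>J. F x $ \<sigma> j = F x' $ \<sigma> j) \<longrightarrow> F x = F x'"
proof -
  let ?r = "rank (jacobian F (at p))"
  obtain J :: "'n set" and \<sigma> where J: "card J = ?r"
    and \<sigma>: "\<forall>u. (\<forall>i\<in>J. (jacobian F (at p) *v u) $ \<sigma> i = 0) \<and> (\<forall>i. i \<notin> J \<longrightarrow> u $ i = 0) \<longrightarrow> u = 0"
    by (rule exists_row_coordinates)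
  define \<phi> where "\<phi> x = (\<chi> i. if i \<in> J then F x $ \<sigma> i - F p $ \<sigma> i else x $ i)" for x
  have d_in: "((\<lambda>x. \<phi> x $ i) has_derivative (\<lambda>u. frechet_derivative F (at x) u $ \<sigma> i)) (at x)"
    if "i \<in> J" "x \<in> U" for i x
    using that smooth_on_has_derivative[OF assms(2) that(2)]
    by (auto simp: \<phi>_def intro!: derivative_eq_intros bounded_linear.has_derivative[OF bounded_linear_vec_nth])
  have d_out: "((\<lambda>x. \<phi> x $ i) has_derivative (\<lambda>u. u $ i)) (at x)" if "i \<notin> J" for i x
    using that bounded_linear_imp_has_derivative[OF bounded_linear_vec_nth] by (simp add: \<phi>_def)
  have sF: "Ck_on k (\<lambda>x. F x $ i) U" for k i
    using smooth_onD[OF assms(2)] by (rule Ck_on_vec_nth[OF assms(1)])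
  have "Ck_on k (\<lambda>x. \<phi> x $ i) U" for k i
  proof (cases "i \<in> J")
    case True
    then show ?thesis
      using Ck_on_add[OF assms(1) sF Ck_on_const, of k "\<sigma> i" "- F p $ \<sigma> i"] by (simp add: \<phi>_def)
  next
    case False
    then show ?thesis
      using Ck_on_bounded_linear[OF assms(1) bounded_linear_vec_nth] by (simp add: \<phi>_def)
  qed
  then have \<phi>: "smooth_on \<phi> U"
    unfolding smooth_on_vec[OF assms(1)] by (simp add: smooth_on_def)
  have D\<phi>: "frechet_derivative \<phi> (at p) u $ i
      = (if i \<in> J then frechet_derivative F (at p) u $ \<sigma> i else u $ i)" for u i
  proof -
    have "frechet_derivative (\<lambda>x. \<phi> x $ i) (at p) u
        = (if i \<in> J then frechet_derivative F (at p) u $ \<sigma> i else u $ i)"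
      using fun_cong[OF frechet_derivative_at[OF d_in[of i p]], of u]
        fun_cong[OF frechet_derivative_at[OF d_out[of i p]], of u] assms(3) by simp
    then show ?thesis
      using frechet_derivative_vec_nth[OF \<phi> assms(3), of i u] by simp
  qed
  have "inj (frechet_derivative \<phi> (at p))"
  proof (rule linear_injective_0[THEN iffD2, rule_format])
    show "linear (frechet_derivative \<phi> (at p))"
      using smooth_on_linear_frechet_derivative[OF \<phi> assms(3)] .
    fix u assume "frechet_derivative \<phi> (at p) u = 0"
    then have *: "(if i \<in> J then frechet_derivative F (at p) u $ \<sigma> i else u $ i) = 0" for i
      using D\<phi>[of u i] by simp
    have "(jacobian F (at p) *v u) $ \<sigma> i = 0" if "i \<in> J" for i
      using *[of i] that by (simp add: jacobian_mult_vec[OF assms(2,3)])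
    moreover have "u $ i = 0" if "i \<notin> J" for i
      using *[of i] that by simp
    ultimately show "u = 0"
      using \<sigma> by blast
  qed
  then obtain V0 W0 \<psi> where 0: "p \<in> V0" "V0 \<subseteq> U" "diffeomorphism V0 W0 \<phi> \<psi>"
    using smooth_local_diffeomorphism[OF assms(1) \<phi> assms(3)] by blast
  then have h0: "homeomorphism V0 W0 \<phi> \<psi>" "open W0"
    by (auto simp: diffeomorphism_def)
  have "\<phi> p \<in> W0" "\<psi> (\<phi> p) = p"
    using h0(1) 0(1) by (auto simp: homeomorphism_def)
  then obtain e where e: "e > 0" "ball (\<phi> p) e \<subseteq> W0"
    using h0(2) open_contains_ball by blast
  \<comment> \<open>A ball, because convexity is used below to join two points of \<open>W\<close>
    by a segment along which \<open>F\<close> is constant.\<close>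
  define W where "W = ball (\<phi> p) e"
  define V where "V = \<psi> ` W"
  have W: "open W" "convex W" "\<phi> p \<in> W"
    using e(1) by (auto simp: W_def)
  have diffeo: "diffeomorphism V W \<phi> \<psi>"
    unfolding V_def using diffeomorphism_restrict[OF 0(3) W(1)] e(2) by (simp add: W_def)
  then have hom: "homeomorphism V W \<phi> \<psi>" and \<psi>: "smooth_on \<psi> W"
    by (auto simp: diffeomorphism_def)
  have VU: "V \<subseteq> U"
    unfolding V_def W_def using e(2) 0(2) h0(1) by (force simp: homeomorphism_def)
  have "p \<in> V"
    unfolding V_def using W(3) \<open>\<psi> (\<phi> p) = p\<close> by force
  have \<psi>U: "\<psi> y \<in> U" and \<phi>\<psi>: "\<phi> (\<psi> y) = y" if "y \<in> W" for y
    using hom VU that by (auto simp: homeomorphism_def)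
  \<comment> \<open>On \<open>W\<close>, \<open>\<phi>\<close> after \<open>\<psi>\<close> is the
    identity, and its \<open>J\<close>-components are components of \<open>F\<close> up to
    constants.\<close>
  have J_coord: "frechet_derivative F (at (\<psi> y)) (frechet_derivative \<psi> (at y) u) $ \<sigma> j = u $ j"
    if "y \<in> W" "j \<in> J" for y u j
  proof -
    have "((\<lambda>y. \<phi> (\<psi> y) $ j) has_derivative
        (\<lambda>u. frechet_derivative F (at (\<psi> y)) (frechet_derivative \<psi> (at y) u) $ \<sigma> j)) (at y)"
      by (rule has_derivative_compose[OF smooth_on_has_derivative[OF \<psi> that(1)] d_in[OF that(2) \<psi>U[OF that(1)]]])
    moreover have "((\<lambda>y. \<phi> (\<psi> y) $ j) has_derivative (\<lambda>u. u $ j)) (at y)"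
      by (rule has_derivative_transform_within_open[OF
            bounded_linear_imp_has_derivative[OF bounded_linear_vec_nth] W(1) that(1)]) (simp add: \<phi>\<psi>)
    ultimately show ?thesis
      using has_derivative_unique by metis
  qed
  \<comment> \<open>In the chart \<open>\<psi>\<close> the rank is already used up by the coordinates in \<open>J\<close>, which are components
    of \<open>F\<close>; so the other directions lie in the kernel.\<close>
  have key: "rank (jacobian F (at (\<psi> y))) = ?r \<and>
      (\<forall>u\<in>coords (- J). frechet_derivative F (at (\<psi> y)) (frechet_derivative \<psi> (at y) u) = 0)"
    if y: "y \<in> W" for y
  proof -
    define L where "L u = frechet_derivative F (at (\<psi> y)) (frechet_derivative \<psi> (at y) u)" for u
    have L: "linear L"
      unfolding L_def
      using linear_compose[OF smooth_on_linear_frechet_derivative[OF \<psi> y]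
          smooth_on_linear_frechet_derivative[OF assms(2) \<psi>U[OF y]]] by (simp add: o_def)
    have Lj: "L u $ \<sigma> j = u $ j" if "j \<in> J" for u j
      unfolding L_def using J_coord[OF y that] .
    have inj: "u = w" if "u \<in> coords J" "w \<in> coords J" "L u = L w" for u w
    proof -
      have "u $ i = w $ i" for i
        using Lj[of i u] Lj[of i w] that by (cases "i \<in> J") (auto simp: coords_def)
      then show ?thesis by (simp add: vec_eq_iff)
    qed
    have dimL: "dim (L ` coords J) = ?r"
    proof -
      have "inj_on L (span (coords J))"
        using inj subspace_coords[of J] by (auto simp: inj_on_def span_eq_iff[THEN iffD2])
      then show ?thesis
        using dim_image_eq[OF L, of "coords J"] J by (simp add: dim_coords)
    qed
    have sub1: "L ` coords J \<subseteq> range L" and sub2: "range L \<subseteq> range (frechet_derivative F (at (\<psi> y)))"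
      by (auto simp: L_def)
    have rk: "rank (jacobian F (at (\<psi> y))) = dim (range (frechet_derivative F (at (\<psi> y))))"
      by (rule rank_jacobian[OF assms(2) \<psi>U[OF y]])
    then have "?r \<le> rank (jacobian F (at (\<psi> y)))"
      using dim_subset[OF sub1] dim_subset[OF sub2] dimL by linarith
    then have rank_eq: "rank (jacobian F (at (\<psi> y))) = ?r"
      using max \<psi>U[OF y] by fastforce
    then have "dim (range L) \<le> dim (L ` coords J)"
      using dim_subset[OF sub2] rk dimL by simp
    then have "L ` coords J = range L"
      using L subspace_coords sub1 by (intro subspace_dim_equal linear_subspace_image subspace_UNIV) auto
    \<comment> \<open>\<open>L u\<close> equals \<open>L w\<close> for some \<open>w\<close> in
      \<open>coords J\<close>; comparing the components \<open>\<sigma> j\<close> gives that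
      \<open>w\<close> agrees with \<open>u\<close> on \<open>J\<close>, so \<open>w\<close> is
      zero.\<close>
    have "L u = 0" if "u \<in> coords (- J)" for u
    proof -
      obtain w where w: "w \<in> coords J" "L u = L w"
        using \<open>L ` coords J = range L\<close> by (metis imageE rangeI)
      have "w $ i = 0" for i
        using Lj[of i u] Lj[of i w] w that by (cases "i \<in> J") (auto simp: coords_def)
      then have "w = 0" by (simp add: vec_eq_iff)
      then show ?thesis
        using w(2) linear_0[OF L] by simp
    qed
    then show ?thesis
      using rank_eq by (simp add: L_def)
  qed
  have eq: "F (\<psi> y) = F (\<psi> y')" if y: "y \<in> W" "y' \<in> W" "y - y' \<in> coords (- J)" for y y'
  proof -
    define z where "z t = y' + t *\<^sub>R (y - y')" for t :: real
    have zW: "z t \<in> W" if "t \<in> {0..1}" for t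
    proof -
      have "z t = (1 - t) *\<^sub>R y' + t *\<^sub>R y"
        by (simp add: z_def algebra_simps)
      then show ?thesis
        using y that convexD_alt[OF W(2), of y' y t] by simp
    qed
    have "((\<lambda>t. F (\<psi> (z t))) has_derivative (\<lambda>s. 0)) (at t within {0..1})" if t: "t \<in> {0..1}" for t
    proof -
      have dz: "(z has_derivative (\<lambda>s. s *\<^sub>R (y - y'))) (at t within {0..1})"
        unfolding z_def by (auto intro!: derivative_eq_intros)
      have "((\<lambda>t. F (\<psi> (z t))) has_derivative (\<lambda>s. frechet_derivative F (at (\<psi> (z t)))
          (frechet_derivative \<psi> (at (z t)) (s *\<^sub>R (y - y'))))) (at t within {0..1})"
        by (rule has_derivative_compose[OF has_derivative_compose[OF dz
                smooth_on_has_derivative[OF \<psi> zW[OF t]]] smooth_on_has_derivative[OF assms(2) \<psi>U[OF zW[OF t]]]])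
      moreover have "s *\<^sub>R (y - y') \<in> coords (- J)" for s
        using y(3) by (rule subspace_scale[OF subspace_coords])
      then have "frechet_derivative F (at (\<psi> (z t))) (frechet_derivative \<psi> (at (z t)) (s *\<^sub>R (y - y'))) = 0" for s
        using key[OF zW[OF t]] by blast
      ultimately show ?thesis by simp
    qed
    then obtain c where c: "\<And>t. t \<in> {0..1} \<Longrightarrow> F (\<psi> (z t)) = c"
      using has_derivative_zero_constant[of "{0..1::real}" "\<lambda>t. F (\<psi> (z t))"] by auto
    then show ?thesis
      using c[of 0] c[of 1] by (simp add: z_def)
  qed
  show thesis
  proof (rule that[OF J \<open>p \<in> V\<close> VU diffeo])
    show "\<forall>x\<in>V. \<forall>j\<in>J. \<phi> x $ j = F x $ \<sigma> j - F p $ \<sigma> j"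
      by (simp add: \<phi>_def)
    show "\<forall>x\<in>V. rank (jacobian F (at x)) = ?r"
      using key by (auto simp: V_def)
    show "\<forall>x\<in>V. \<forall>x'\<in>V. (\<forall>j\<in>J. F x $ \<sigma> j = F x' $ \<sigma> j) \<longrightarrow> F x = F x'"
    proof (intro ballI impI)
      fix x x' assume x: "x \<in> V" "x' \<in> V" "\<forall>j\<in>J. F x $ \<sigma> j = F x' $ \<sigma> j"
      have "\<phi> x \<in> W" "\<phi> x' \<in> W" "\<psi> (\<phi> x) = x" "\<psi> (\<phi> x') = x'"
        using hom x(1,2) by (auto simp: homeomorphism_def)
      moreover have "\<phi> x - \<phi> x' \<in> coords (- J)"
        using x(3) by (auto simp: coords_def \<phi>_def)
      ultimately show "F x = F x'"
        using eq[of "\<phi> x" "\<phi> x'"] by simp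
    qed
  qed
qed

section \<open>Fibres and points of smaller rank\<close>

text \<open>The selected components of the range of the derivative span a proper subspace of
  \<open>coords J\<close>, and a vector orthogonal to it is the required covector. The choice
  \<open>\<sigma>\<close> is arbitrary, so it may come from a chart at another point, and the shifts
  \<open>c j\<close> match the normalisation of that chart.\<close>

lemma rank_deficient_in_crit:
  fixes F :: "real^'n::finite \<Rightarrow> real^'m::finite"
  assumes "smooth_on F U" "q \<in> U" "rank (jacobian F (at q)) < card J"
  shows "q \<in> crit UNIV J (\<lambda>j x. F x $ \<sigma> j - c j) U"
proof -
  let ?D = "frechet_derivative F (at q)"
  define P where "P w = (\<chi> j. if j \<in> J then w $ \<sigma> j else (0::real))" for w :: "real^'m"
  have P: "linear P"
    by (rule linearI) (auto simp: P_def vec_eq_iff)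
  have "dim (P ` range ?D) \<le> dim (range ?D)"
    by (rule dim_image_le[OF P])
  also have "\<dots> < dim (coords J)"
    using assms(3) by (simp add: dim_coords rank_jacobian[OF assms(1,2)])
  finally have "dim (P ` range ?D) < dim (coords J)" .
  moreover have "P ` range ?D \<subseteq> coords J"
    by (auto simp: P_def coords_def)
  ultimately have "span (P ` range ?D) \<subset> span (coords J)"
    by (metis dim_span less_irrefl psubsetI span_mono)
  then obtain v where v: "v \<noteq> 0" "v \<in> span (coords J)"
    "\<And>y. y \<in> span (P ` range ?D) \<Longrightarrow> orthogonal v y"
    using orthogonal_to_subspace_exists_gen by blast
  have "v \<in> coords J"
    using v(2) subspace_coords[of J] by (metis span_eq_iff)
  moreover have "(\<Sum>j\<in>J. v $ j * frechet_derivative (\<lambda>x. F x $ \<sigma> j - c j) (at q) u) = 0" for u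
  proof -
    have "((\<lambda>x. F x $ \<sigma> j - c j) has_derivative (\<lambda>u. ?D u $ \<sigma> j)) (at q)" for j
      using smooth_on_has_derivative[OF assms(1,2)]
      by (auto intro!: derivative_eq_intros bounded_linear.has_derivative[OF bounded_linear_vec_nth])
    then have D: "frechet_derivative (\<lambda>x. F x $ \<sigma> j - c j) (at q) u = ?D u $ \<sigma> j" for j
      using frechet_derivative_at by metis
    have "v \<bullet> P (?D u) = 0"
      using v(3)[OF span_base, of "P (?D u)"] by (simp add: orthogonal_def)
    also have "v \<bullet> P (?D u) = (\<Sum>j\<in>UNIV. if j \<in> J then v $ j * ?D u $ \<sigma> j else 0)"
      by (auto simp: inner_vec_def P_def intro!: sum.cong)
    also have "\<dots> = (\<Sum>j\<in>J. v $ j * ?D u $ \<sigma> j)"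
      by (simp add: sum.If_cases)
    finally show ?thesis by (simp add: D)
  qed
  ultimately show ?thesis
    using v(1) assms(2) by (auto simp: crit_def coords_def)
qed

text \<open>The maximal rank chart at a fibre point \<open>q\<close> is normalised to have its
  \<open>J\<close>-coordinates zero at \<open>q\<close>. Inside it the fibre is where these
  coordinates vanish, so it is a slice with free index set \<open>- J\<close>.\<close>

lemma embedded_submanifold_fibre:
  fixes F :: "real^'n::finite \<Rightarrow> real^'m::finite"
  assumes "open U" "smooth_on F U"
    and max: "\<And>x. x \<in> U \<Longrightarrow> rank (jacobian F (at x)) \<le> r"
    and fibre: "\<And>q. q \<in> SolSet U F p \<Longrightarrow> rank (jacobian F (at q)) = r"
  shows "embedded_submanifold U (CARD('n) - r) (SolSet U F p)"
  unfolding embedded_submanifold_def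
proof (intro conjI ballI)
  show "SolSet U F p \<subseteq> U"
    by (auto simp: SolSet_def)
  fix q assume q: "q \<in> SolSet U F p"
  then have qU: "q \<in> U" and Fq: "F q = F p" and rq: "rank (jacobian F (at q)) = r"
    using fibre by (auto simp: SolSet_def)
  have max': "\<forall>x\<in>U. rank (jacobian F (at x)) \<le> rank (jacobian F (at q))"
    using max rq by simp
  obtain J :: "'n set" and \<sigma> :: "'n \<Rightarrow> 'm" and V W :: "(real^'n) set"
    and \<phi> \<psi> :: "real^'n \<Rightarrow> real^'n" where c: "card J = rank (jacobian F (at q))"
    "q \<in> V" "V \<subseteq> U" "diffeomorphism V W \<phi> \<psi>"
    "\<forall>x\<in>V. \<forall>j\<in>J. \<phi> x $ j = F x $ \<sigma> j - F q $ \<sigma> j"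
    "\<forall>x\<in>V. rank (jacobian F (at x)) = rank (jacobian F (at q))"
    "\<forall>x\<in>V. \<forall>x'\<in>V. (\<forall>j\<in>J. F x $ \<sigma> j = F x' $ \<sigma> j) \<longrightarrow> F x = F x'"
    by (rule max_rank_chart[OF assms(1,2) qU max']) (rule that; assumption)
  have "x \<in> SolSet U F p \<longleftrightarrow> (\<forall>i. i \<notin> - J \<longrightarrow> \<phi> x $ i = 0)" if "x \<in> V" for x
  proof -
    have "x \<in> SolSet U F p \<longleftrightarrow> F x = F q"
      using that c(3) Fq by (auto simp: SolSet_def)
    also have "\<dots> \<longleftrightarrow> (\<forall>j\<in>J. F x $ \<sigma> j = F q $ \<sigma> j)"
      using c(7)[rule_format, OF that c(2)] by auto
    also have "\<dots> \<longleftrightarrow> (\<forall>i. i \<notin> - J \<longrightarrow> \<phi> x $ i = 0)"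
      using bspec[OF c(5) that] by (simp add: Ball_def)
    finally show ?thesis .
  qed
  moreover have "\<phi> ` V = W"
    using c(4) by (auto simp: diffeomorphism_def homeomorphism_def)
  ultimately have "\<phi> ` (SolSet U F p \<inter> V) = W \<inter> {y. \<forall>i. i \<notin> - J \<longrightarrow> y $ i = 0}"
    by blast
  moreover have "card (- J) = CARD('n) - r"
    using c(1) rq by (simp add: Compl_eq_Diff_UNIV card_Diff_subset)
  ultimately have "q \<in> V \<and> V \<subseteq> U \<and> diffeomorphism V W \<phi> \<psi> \<and> card (- J) = CARD('n) - r \<and>
      \<phi> ` (SolSet U F p \<inter> V) = W \<inter> {y. \<forall>i. i \<notin> - J \<longrightarrow> y $ i = 0}"
    using c(2,3,4) by (intro conjI)
  then show "\<exists>V W \<phi> \<psi> I. q \<in> V \<and> V \<subseteq> U \<and> diffeomorphism V W \<phi> \<psi> \<and> card I = CARD('n) - r \<and>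
      \<phi> ` (SolSet U F p \<inter> V) = W \<inter> {y :: real^'n. \<forall>i. i \<notin> I \<longrightarrow> y $ i = 0}"
    by blast
qed

lemma diffeomorphism_inj_derivative:
  fixes \<phi> :: "'a::real_normed_vector \<Rightarrow> 'b::real_normed_vector"
  assumes "diffeomorphism V W \<phi> \<psi>" "x \<in> V"
  shows "inj (frechet_derivative \<phi> (at x))"
proof -
  have d: "open V" "homeomorphism V W \<phi> \<psi>" "smooth_on \<phi> V" "smooth_on \<psi> W"
    using assms(1) by (auto simp: diffeomorphism_def)
  have W: "\<phi> x \<in> W" and inv: "\<And>x. x \<in> V \<Longrightarrow> \<psi> (\<phi> x) = x"
    using d(2) assms(2) by (auto simp: homeomorphism_def)
  have "((\<lambda>x. \<psi> (\<phi> x)) has_derivative (\<lambda>v. v)) (at x)"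
    by (rule has_derivative_transform_within_open[OF has_derivative_ident d(1) assms(2)]) (simp add: inv)
  then have "frechet_derivative (\<lambda>x. \<psi> (\<phi> x)) (at x) v = v" for v
    using frechet_derivative_at by metis
  then have "frechet_derivative \<psi> (at (\<phi> x)) (frechet_derivative \<phi> (at x) v) = v" for v
    by (simp add: frechet_derivative_comp[OF d(3,4) assms(2) W])
  then show ?thesis
    by (rule inj_on_inverseI)
qed

text \<open>In a chart near \<open>p\<close>, a point whose fibre contains a deficient
  \<open>q\<close> has the \<open>J\<close>-coordinates of a critical value, so its chart image lies
  in a null cylinder. Preimages of null sets under a map with injective derivatives are
  null.\<close>

lemma negligible_fibres_through_deficient:
  fixes F :: "real^'n::finite \<Rightarrow> real^'m::finite"
  assumes "open U" "smooth_on F U"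
    and max: "\<And>x. x \<in> U \<Longrightarrow> rank (jacobian F (at x)) \<le> r"
  shows "negligible {p \<in> U. rank (jacobian F (at p)) = r \<and> (\<exists>q\<in>U. F q = F p \<and> rank (jacobian F (at q)) < r)}"
    (is "negligible ?N")
proof (rule locally_negligible_alt[THEN iffD2], rule ballI)
  fix p assume p: "p \<in> ?N"
  then have pU: "p \<in> U" and rp: "rank (jacobian F (at p)) = r"
    by auto
  have max': "\<forall>x\<in>U. rank (jacobian F (at x)) \<le> rank (jacobian F (at p))"
    using max rp by simp
  obtain J :: "'n set" and \<sigma> :: "'n \<Rightarrow> 'm" and V W :: "(real^'n) set"
    and \<phi> \<psi> :: "real^'n \<Rightarrow> real^'n" where c: "card J = rank (jacobian F (at p))"
    "p \<in> V" "V \<subseteq> U" "diffeomorphism V W \<phi> \<psi>"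
    "\<forall>x\<in>V. \<forall>j\<in>J. \<phi> x $ j = F x $ \<sigma> j - F p $ \<sigma> j"
    "\<forall>x\<in>V. rank (jacobian F (at x)) = rank (jacobian F (at p))"
    "\<forall>x\<in>V. \<forall>x'\<in>V. (\<forall>j\<in>J. F x $ \<sigma> j = F x' $ \<sigma> j) \<longrightarrow> F x = F x'"
    by (rule max_rank_chart[OF assms(1,2) pU max']) (rule that; assumption)
  have V: "open V" "smooth_on \<phi> V"
    using c(4) by (auto simp: diffeomorphism_def)
  \<comment> \<open>Defined on all of \<open>U\<close>, since the deficient point \<open>q\<close>
    may lie outside the chart domain \<open>V\<close>; on \<open>V\<close> these are the
    \<open>J\<close>-components of \<open>\<phi>\<close>.\<close>
  define f where "f j x = F x $ \<sigma> j - F p $ \<sigma> j" for j x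
  have "smooth_on (f j) U" for j
    unfolding f_def smooth_on_def
    using Ck_on_add[OF assms(1) Ck_on_vec_nth[OF assms(1) smooth_onD[OF assms(2)]] Ck_on_const,
        of _ "\<sigma> j" "- F p $ \<sigma> j"] by simp
  then have "negligible (cylinder J f (crit UNIV J f U))"
    by (rule Sard_cylinder[OF assms(1)])
  then have "negligible {x \<in> V. \<phi> x \<in> cylinder J f (crit UNIV J f U)}"
  proof (rule negligible_differentiable_vimage)
    show "(\<phi> has_derivative frechet_derivative \<phi> (at x)) (at x within V)" if "x \<in> V" for x
      using smooth_on_has_derivative[OF V(2) that] by (rule has_derivative_at_withinI)
  qed (rule diffeomorphism_inj_derivative[OF c(4)])
  moreover have "?N \<inter> V \<subseteq> {x \<in> V. \<phi> x \<in> cylinder J f (crit UNIV J f U)}"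
  proof clarify
    fix x q assume x: "x \<in> V" "q \<in> U" "F q = F x" "rank (jacobian F (at q)) < rank (jacobian F (at x))"
    then have "rank (jacobian F (at q)) < card J"
      using c(1,6) by simp
    then have "q \<in> crit UNIV J f U"
      unfolding f_def by (rule rank_deficient_in_crit[OF assms(2) x(2)])
    moreover have "\<forall>j\<in>J. \<phi> x $ j = f j q"
      using c(5) x(1,3) by (simp add: f_def)
    ultimately show "\<phi> x \<in> cylinder J f (crit UNIV J f U)"
      unfolding cylinder_def by blast
  qed
  ultimately have "negligible (?N \<inter> V)"
    by (rule negligible_subset)
  moreover have "openin (top_of_set ?N) (?N \<inter> V)"
    using V(1) by (simp add: openin_open_Int)
  ultimately show "\<exists>T. openin (top_of_set ?N) T \<and> p \<in> T \<and> negligible T"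
    using p c(2) by blast
qed

section \<open>From almost constant rank to flatness\<close>

theorem theorem2:
  fixes U :: "(real^'n::finite) set" and F :: "real^'n \<Rightarrow> real^'m::finite"
  assumes "open U"
    and "smooth_on F U"
    and "ACR U F"
  shows "d_flat (CARD('n) - maxrank U F) U F"
proof -
  let ?rk = "\<lambda>x. rank (jacobian F (at x))"
  let ?r = "maxrank U F"
  have Uleb: "U \<inter> space lebesgue \<in> sets lebesgue"
    using assms(1) by simp
  have AE_U: "(AE x in lebesgue_on U. P x) \<longleftrightarrow> negligible {x \<in> U. \<not> P x}" for P
  proof -
    have "(AE x in lebesgue_on U. P x) \<longleftrightarrow> (\<exists>N. negligible N \<and> {x \<in> U. \<not> P x} \<subseteq> N)"
      by (simp add: AE_restrict_space_iff[OF Uleb] eventually_ae_filter_negligible)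
    then show ?thesis
      by (blast intro: negligible_subset)
  qed
  obtain \<rho> where \<rho>: "negligible {x \<in> U. ?rk x \<noteq> \<rho>}"
    using assms(3) unfolding ACR_def AE_U by blast
  have fin: "finite (?rk ` U)"
  proof (rule finite_subset)
    show "?rk ` U \<subseteq> {..CARD('n)}"
      using rank_bound[of "jacobian F (at _)"] by force
  qed simp
  have max: "?rk x \<le> ?r" if "x \<in> U" for x
    unfolding maxrank_def using fin that by simp
  \<comment> \<open>The maximal rank is attained on a nonempty open set, which is not null, so the
    almost everywhere value \<open>\<rho>\<close> must be the maximum.\<close>
  have neg: "negligible {x \<in> U. ?rk x \<noteq> ?r}"
  proof (cases "U = {}")
    case False
    then have "?r \<in> ?rk ` U"
      unfolding maxrank_def using fin by (intro Max_in) auto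
    then obtain p where p: "p \<in> U" "?rk p = ?r" by auto
    have max': "\<forall>x\<in>U. ?rk x \<le> ?rk p"
      using max p(2) by simp
    obtain J :: "'n set" and \<sigma> :: "'n \<Rightarrow> 'm" and V W :: "(real^'n) set"
    and \<phi> \<psi> :: "real^'n \<Rightarrow> real^'n" where c: "card J = ?rk p"
      "p \<in> V" "V \<subseteq> U" "diffeomorphism V W \<phi> \<psi>"
      "\<forall>x\<in>V. \<forall>j\<in>J. \<phi> x $ j = F x $ \<sigma> j - F p $ \<sigma> j"
      "\<forall>x\<in>V. ?rk x = ?rk p"
      "\<forall>x\<in>V. \<forall>x'\<in>V. (\<forall>j\<in>J. F x $ \<sigma> j = F x' $ \<sigma> j) \<longrightarrow> F x = F x'"
      by (rule max_rank_chart[OF assms(1,2) p(1) max']) (rule that; assumption)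
    have "\<not> negligible V"
      using c(2,4) open_not_negligible by (auto simp: diffeomorphism_def)
    then have "\<not> V \<subseteq> {x \<in> U. ?rk x \<noteq> \<rho>}"
      using \<rho> negligible_subset by blast
    then have "\<rho> = ?r"
      using c(3,6) p(2) by auto
    then show ?thesis using \<rho> by simp
  qed simp
  let ?N = "{p \<in> U. ?rk p = ?r \<and> (\<exists>q\<in>U. F q = F p \<and> ?rk q < ?r)}"
  have "negligible ({x \<in> U. ?rk x \<noteq> ?r} \<union> ?N)"
    using neg negligible_fibres_through_deficient[OF assms(1,2) max] by (rule negligible_Un)
  moreover have "{p \<in> U. \<not> embedded_submanifold U (CARD('n) - ?r) (SolSet U F p)}
      \<subseteq> {x \<in> U. ?rk x \<noteq> ?r} \<union> ?N"
  proof (rule subsetI, rule ccontr)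
    fix p assume p: "p \<in> {p \<in> U. \<not> embedded_submanifold U (CARD('n) - ?r) (SolSet U F p)}"
      "p \<notin> {x \<in> U. ?rk x \<noteq> ?r} \<union> ?N"
    have "?rk q = ?r" if "q \<in> SolSet U F p" for q
      using that p max[of q] by (auto simp: SolSet_def)
    then show False
      using embedded_submanifold_fibre[OF assms(1,2) max] p(1) by blast
  qed
  ultimately have "negligible {p \<in> U. \<not> embedded_submanifold U (CARD('n) - ?r) (SolSet U F p)}"
    by (rule negligible_subset)
  then show ?thesis
    unfolding d_flat_def AE_U .
qed

end
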